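(* Let $S$ be the set of integral points in some rational polyhedron of $\mathbb{R}^n$ such that $\dim(S)=n$. A set $B\subset \mathbb{R}^n$ is a maximal $S$-free convex set if and only if one of the following holds: (i) $B$ is a polyhedron such that $B\cap \mathrm{conv}(S)$ has nonempty interior, $B$ does not contain any point of $S$ in its interior, and there is a point of $S$ in the relative interior of each of the facets of $B$; (ii) $B$ is a half-space of $\mathbb{R}^n$ such that $B\cap \mathrm{conv}(S)$ has empty interior and the boundary of $B$ is a supporting hyperplane of $\mathrm{conv}(S)$; (iii) $B$ is a hyperplane of $\mathbb{R}^n$ such that $\mathrm{lin}(B)\cap\mathrm{rec}(\mathrm{conv}(S))$ is not rational. Furthermore, if (i) holds, the recession cone of $B\cap\mathrm{conv}(S)$ is rational and it is contained in the lineality space of $B$.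
   Context: A polyhedron is rational if it can be written as $\{x\in\mathbb{R}^n : Ax\le b\}$ with finitely many inequalities, where the matrix $A$ and the vector $b$ have rational entries. The condition $\dim(S)=n$ means that $S$ contains $n+1$ affinely independent points. A set $B\subset\mathbb{R}^n$ is an $S$-free convex set if $B$ is convex and contains no point of $S$ in its interior; it is a maximal $S$-free convex set if it is an $S$-free convex set that is not properly contained in any $S$-free convex set. Hyperplanes are affine hyperplanes, and half-spaces are closed affine half-spaces. For a convex set $K\subset\mathbb{R}^n$, $\mathrm{rec}(K)=\{r : x+\lambda r\in K \text{ for all } x\in K,\ \lambda\ge 0\}$ is its recession cone and $\mathrm{lin}(K)=\mathrm{rec}(K)\cap(-\mathrm{rec}(K))$ its lineality space. A linear subspace or cone in $\mathbb{R}^n$ is rational if it can be generated by rational vectors, i.e. vectors with rational coordinates. A supporting hyperplane of a convex set is a hyperplane that meets it and has the set entirely in one of its two closed half-spaces. *)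

theory Defs
  imports "HOL-Analysis.Analysis"
begin

definition integral_points :: "(real ^ 'n) set" where
  "integral_points = {x. \<forall>i. x $ i \<in> \<int>}"

definition rational_points :: "(real ^ 'n) set" where
  "rational_points = {x. \<forall>i. x $ i \<in> \<rat>}"

text \<open>The pairs \<open>(a, b)\<close> in \<open>F\<close> are the rows of the system \<open>A x \<le> b\<close>.
  Zero rows and the empty system are allowed, so the empty set and the whole space
  are rational polyhedra.\<close>

definition rational_polyhedron :: "(real ^ 'n) set \<Rightarrow> bool" where
  "rational_polyhedron P \<longleftrightarrow>
     (\<exists>F. finite F \<and> F \<subseteq> rational_points \<times> \<rat> \<and> P = {x. \<forall>(a, b)\<in>F. a \<bullet> x \<le> b})"

text \<open>\<open>T\<close> is finite because its cardinality is positive.\<close>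

definition full_dimensional :: "(real ^ 'n) set \<Rightarrow> bool" where
  "full_dimensional S \<longleftrightarrow>
     (\<exists>T \<subseteq> S. \<not> affine_dependent T \<and> card T = CARD('n) + 1)"

definition free_convex :: "'a::euclidean_space set \<Rightarrow> 'a set \<Rightarrow> bool" where
  "free_convex S B \<longleftrightarrow> convex B \<and> interior B \<inter> S = {}"

definition maximal_free_convex :: "'a::euclidean_space set \<Rightarrow> 'a set \<Rightarrow> bool" where
  "maximal_free_convex S B \<longleftrightarrow> free_convex S B \<and> \<not> (\<exists>C. free_convex S C \<and> B \<subset> C)"

definition is_hyperplane :: "'a::euclidean_space set \<Rightarrow> bool" where
  "is_hyperplane H \<longleftrightarrow> (\<exists>a b. a \<noteq> 0 \<and> H = {x. a \<bullet> x = b})"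

definition is_halfspace :: "'a::euclidean_space set \<Rightarrow> bool" where
  "is_halfspace H \<longleftrightarrow> (\<exists>a b. a \<noteq> 0 \<and> H = {x. a \<bullet> x \<le> b})"

definition supporting_hyperplane :: "'a::euclidean_space set \<Rightarrow> 'a set \<Rightarrow> bool" where
  "supporting_hyperplane H K \<longleftrightarrow>
     H \<inter> K \<noteq> {} \<and>
     (\<exists>a b. a \<noteq> 0 \<and> H = {x. a \<bullet> x = b} \<and>
            (K \<subseteq> {x. a \<bullet> x \<le> b} \<or> K \<subseteq> {x. a \<bullet> x \<ge> b}))"

definition recession_cone :: "'a::euclidean_space set \<Rightarrow> 'a set" where
  "recession_cone K = {r. \<forall>x\<in>K. \<forall>l\<ge>0. x + l *\<^sub>R r \<in> K}"

definition lineality_space :: "'a::euclidean_space set \<Rightarrow> 'a set" where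
  "lineality_space K = recession_cone K \<inter> uminus ` recession_cone K"

text \<open>\<open>convex_cone hull V\<close> is the set of all finite nonnegative combinations of vectors
  in \<open>V\<close>; for \<open>V = {}\<close> it is \<open>{0}\<close>, so the trivial cone is rational. A linear subspace
  is generated by rational vectors as a subspace iff it is so as a cone, by
  closing the generators under negation.\<close>

definition rational_cone :: "(real ^ 'n) set \<Rightarrow> bool" where
  "rational_cone K \<longleftrightarrow> (\<exists>V \<subseteq> rational_points. K = convex_cone hull V)"

end

theory Submission
  imports Defs
begin

text \<open>By Dickson's lemma \<open>S = F + M\<close> for a finite set \<open>F\<close> and the monoid \<open>M\<close> generated by a finite
  set \<open>G\<close> of integral vectors, so \<open>conv S\<close> is closed with recession cone \<open>K = cone G\<close>.
  Fix a subspace \<open>L\<close>. Simultaneous Diophantine approximation of the coefficients of the points of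
  \<open>K \<inter> L\<close> gives elements of \<open>M\<close> close to \<open>L\<close>. Either all those that are sufficiently close lie
  in \<open>L\<close>, and then \<open>L \<inter> K\<close> is rational and \<open>M\<close> is discrete modulo \<open>L\<close>, or the closure of
  \<open>M + L\<close> contains a line outside \<open>L\<close>. If \<open>L\<close> is the lineality space of a maximal set \<open>B\<close> with
  nonempty interior, the second case is impossible since \<open>B\<close> could be extended along that line;
  hence modulo \<open>L\<close> only finitely many points of \<open>S\<close> matter, and \<open>B\<close> is a polyhedron. If \<open>L\<close> is
  the direction of a hyperplane, the second case says that every strip along the hyperplane
  meets \<open>S\<close>, which is maximality.\<close>

section \<open>Finite generation of the integral points of a rational polyhedron\<close>

text \<open>The lineality space \<open>L\<close> may be irrational, so projecting all integral
  points along \<open>L\<close> can give a dense set; only the monoid \<open>M\<close>, not the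
  group it generates, can be expected to stay discrete. For pairs of natural numbers and a line of
  negative irrational slope the projections are locally finite, while those of all integral pairs
  are dense. The generators therefore split into those that occur with a positive coefficient in a
  representation of a point of \<open>L \<inter> K\<close>, which can be cancelled up to small
  errors, and the others, whose coefficients stay bounded along sequences with bounded projections.
  The dichotomy is stated for elements \<open>u\<close> with \<open>- u\<close> in the closure of
  \<open>M + L\<close>, because a limit of their directions gives a whole line and not merely a ray.
  Approximation alone yields rational points of \<open>L \<inter> K\<close> only near a prescribed
  point; exact rationality comes from the fact that a convex set and its closure have the same
  relative interior.\<close>

lemma eventually_const_of_mono_bounded:
  fixes f :: "nat \<Rightarrow> nat"
  assumes "mono f" and "\<And>n. f n \<le> B"
  obtains N where "\<And>n. n \<ge> N \<Longrightarrow> f n = f N"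
proof -
  have fin: "finite (range f)"
    using assms(2) by (meson finite_atMost finite_subset image_subsetI atMost_iff)
  then have "Max (range f) \<in> range f" by (intro Max_in) auto
  then obtain N where N: "f N = Max (range f)" by auto
  have "f n = f N" if "n \<ge> N" for n
    using monoD[OF assms(1) that] fin N by (metis Max_ge le_antisym rangeI)
  then show ?thesis using that by blast
qed

text \<open>A decreasing sequence of natural numbers is eventually constant, so a monotone
  subsequence of either kind has an increasing tail.\<close>

lemma mono_subsequence_nat:
  fixes f :: "nat \<Rightarrow> nat"
  obtains r :: "nat \<Rightarrow> nat" where "strict_mono r" "mono (f \<circ> r)"
proof -
  obtain r where r: "strict_mono r" "monoseq (\<lambda>n. f (r n))"
    using seq_monosub by blast
  show ?thesis
  proof (cases "incseq (\<lambda>n. f (r n))")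
    case True
    then show ?thesis using r that by (auto simp: o_def)
  next
    case False
    then have dec: "decseq (\<lambda>n. f (r n))" using r(2) monoseq_iff by blast
    have "(LEAST k. k \<in> range (\<lambda>n. f (r n))) \<in> range (\<lambda>n. f (r n))"
      by (rule LeastI[of _ "f (r 0)"]) simp
    then obtain N where N: "(LEAST k. k \<in> range (\<lambda>n. f (r n))) = f (r N)"
      by (rule imageE)
    have const: "f (r n) = f (r N)" if "n \<ge> N" for n
    proof (rule le_antisym)
      show "f (r n) \<le> f (r N)" using dec that by (rule decseqD)
      show "f (r N) \<le> f (r n)" unfolding N[symmetric] by (rule Least_le) simp
    qed
    have "(f \<circ> (\<lambda>n. r (n + N))) m = f (r N)" for m
      using const[of "m + N"] by simp
    then have "mono (f \<circ> (\<lambda>n. r (n + N)))" by (intro monoI) presburger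
    moreover have "strict_mono (\<lambda>n. r (n + N))" using r(1) by (auto simp: strict_mono_def)
    ultimately show ?thesis using that by blast
  qed
qed

lemma mono_subsequence_nat_family:
  fixes \<phi> :: "'i \<Rightarrow> nat \<Rightarrow> nat"
  assumes "finite I"
  shows "\<exists>r::nat \<Rightarrow> nat. strict_mono r \<and> (\<forall>i\<in>I. mono (\<phi> i \<circ> r))"
  using assms
proof (induction I)
  case empty
  then show ?case using strict_mono_id by blast
next
  case (insert i I)
  then obtain r :: "nat \<Rightarrow> nat" where r: "strict_mono r" "\<forall>i\<in>I. mono (\<phi> i \<circ> r)" by blast
  obtain r' :: "nat \<Rightarrow> nat" where r': "strict_mono r'" "mono ((\<phi> i \<circ> r) \<circ> r')"
    using mono_subsequence_nat by blast
  have "mono (\<phi> j \<circ> (r \<circ> r'))" if "j \<in> I" for j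
    using r(2) r'(1) that by (simp add: mono_def strict_mono_leD)
  moreover have "strict_mono (r \<circ> r')" using r(1) r'(1) by (rule strict_mono_o)
  moreover have "mono (\<phi> i \<circ> (r \<circ> r'))" using r'(2) by (simp only: o_assoc)
  ultimately show ?case by blast
qed

text \<open>Otherwise points of \<open>X\<close> can be chosen one after another, each failing to
  dominate every earlier one. A subsequence along which all \<open>\<phi> i\<close> increase
  contradicts this. The order is given by arbitrary measurements \<open>\<phi> i\<close>, so that
  slacks of inequalities and parts of coordinates can be mixed.\<close>

lemma Dickson:
  fixes \<phi> :: "'i \<Rightarrow> 'x \<Rightarrow> nat"
  assumes "finite I"
  obtains F where "finite F" "F \<subseteq> X" "\<And>y. y \<in> X \<Longrightarrow> \<exists>x\<in>F. \<forall>i\<in>I. \<phi> i x \<le> \<phi> i y"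
proof -
  have "\<exists>F. finite F \<and> F \<subseteq> X \<and> (\<forall>y\<in>X. \<exists>x\<in>F. \<forall>i\<in>I. \<phi> i x \<le> \<phi> i y)"
  proof (rule ccontr)
    assume "\<not> ?thesis"
    then have "\<forall>F. \<exists>y. finite F \<longrightarrow> F \<subseteq> X \<longrightarrow> y \<in> X \<and> (\<forall>x\<in>F. \<exists>i\<in>I. \<phi> i y < \<phi> i x)"
      by (metis leI)
    then obtain c where c: "\<And>F. finite F \<Longrightarrow> F \<subseteq> X \<Longrightarrow> c F \<in> X \<and> (\<forall>x\<in>F. \<exists>i\<in>I. \<phi> i (c F) < \<phi> i x)"
      by metis
    define A where "A = rec_nat {} (\<lambda>_ F. insert (c F) F)"
    have A0: "A 0 = {}" and AS: "\<And>n. A (Suc n) = insert (c (A n)) (A n)"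
      by (auto simp: A_def)
    have A: "finite (A n) \<and> A n \<subseteq> X" for n
      by (induction n) (use A0 AS c in auto)
    have mem: "c (A m) \<in> A n" if "m < n" for m n
      using that by (induction n) (auto simp: AS less_Suc_eq)
    obtain r :: "nat \<Rightarrow> nat" where r: "strict_mono r" "\<forall>i\<in>I. mono ((\<lambda>n. \<phi> i (c (A n))) \<circ> r)"
      using mono_subsequence_nat_family[OF assms, of "\<lambda>i n. \<phi> i (c (A n))"] by blast
    have "c (A (r 0)) \<in> A (r 1)" using r(1) mem by (simp add: strict_mono_less)
    then obtain i where "i \<in> I" "\<phi> i (c (A (r 1))) < \<phi> i (c (A (r 0)))"
      using c A by meson
    moreover have "\<phi> i (c (A (r 0))) \<le> \<phi> i (c (A (r 1)))" if "i \<in> I" for i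
      using r(2) that by (auto simp: mono_def)
    ultimately show False by (meson leD)
  qed
  then show ?thesis using that by blast
qed

section \<open>Nonnegative integer combinations and the integral points of a polyhedron\<close>

definition nat_span :: "'a::real_vector set \<Rightarrow> 'a set" where
  "nat_span G = range (\<lambda>p. \<Sum>g\<in>G. real (p g) *\<^sub>R g)"

lemma nat_spanI: "(\<Sum>g\<in>G. real (p g) *\<^sub>R g) \<in> nat_span G"
  by (auto simp: nat_span_def)

lemma nat_span_0: "0 \<in> nat_span G"
  using nat_spanI[of "\<lambda>_. 0" G] by simp

lemma nat_span_add: "x \<in> nat_span G \<Longrightarrow> y \<in> nat_span G \<Longrightarrow> x + y \<in> nat_span G"
proof -
  assume "x \<in> nat_span G" "y \<in> nat_span G"
  then obtain p q where "x = (\<Sum>g\<in>G. real (p g) *\<^sub>R g)" "y = (\<Sum>g\<in>G. real (q g) *\<^sub>R g)"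
    by (auto simp: nat_span_def)
  then have "x + y = (\<Sum>g\<in>G. real (p g + q g) *\<^sub>R g)"
    by (simp add: sum.distrib scaleR_left_distrib)
  then show ?thesis using nat_spanI[of "\<lambda>g. p g + q g"] by metis
qed

lemma nat_span_base: "finite G \<Longrightarrow> g \<in> G \<Longrightarrow> g \<in> nat_span G"
  using nat_spanI[of "\<lambda>h. if h = g then 1 else 0" G]
  by (simp add: if_distrib[of real] if_distrib[of "\<lambda>c. c *\<^sub>R _"] cong: if_cong)

lemma nat_span_mult: "x \<in> nat_span G \<Longrightarrow> real n *\<^sub>R x \<in> nat_span G"
  by (induction n) (auto simp: nat_span_0 nat_span_add scaleR_left_distrib)

lemma common_denominator:
  assumes "finite G" "\<And>g. g \<in> G \<Longrightarrow> t g \<in> \<rat>"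
  obtains N :: nat where "0 < N" "\<And>g. g \<in> G \<Longrightarrow> real N * t g \<in> \<int>"
proof -
  have "\<exists>N::nat. 0 < N \<and> (\<forall>g\<in>G. real N * t g \<in> \<int>)"
    using assms
  proof (induction G)
    case (insert j J)
    then obtain N where N: "N > 0" "\<forall>i\<in>J. real N * t i \<in> \<int>" by auto
    have "t j \<in> \<rat>" using insert.prems by simp
    then obtain k l where kl: "l > 0" "t j = of_int k / of_int l"
      by (meson Rats_cases')
    have e1: "real (N * nat l) * t i = of_int l * (real N * t i)" for i
      using kl by simp
    have "real (N * nat l) * t j = of_int (int N * k)"
      using kl by simp
    then have "\<forall>i\<in>insert j J. real (N * nat l) * t i \<in> \<int>"
      using N(2) by (metis Ints_mult Ints_of_int e1 insert_iff)
    moreover have "N * nat l > 0" using N kl by simp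
    ultimately show ?case by blast
  qed (auto intro: exI[of _ 1])
  then show ?thesis using that by blast
qed

text \<open>Points are compared by the slacks of the rows and by the positive and negative parts of
  the coordinates. If \<open>x\<close> is below \<open>y\<close>, then \<open>y - x\<close>
  satisfies the homogeneous system. \<open>F\<close> dominates from below in \<open>S\<close>, and
  \<open>G\<close> among the nonzero solutions of the homogeneous system; subtracting an element of
  \<open>G\<close> lowers the sum of the absolute values of the coordinates, so the subtraction
  terminates.\<close>

lemma int_points_of_rational_polyhedron:
  fixes P :: "(real ^ 'n) set"
  assumes "rational_polyhedron P"
  obtains F G where "finite F" "finite G" "G \<subseteq> integral_points"
    "P \<inter> integral_points = {f + u |f u. f \<in> F \<and> u \<in> nat_span G}"
proof -
  obtain R where R: "finite R" "R \<subseteq> rational_points \<times> \<rat>"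
    and P: "P = {x. \<forall>(a, b)\<in>R. a \<bullet> x \<le> b}"
    using assms by (auto simp: rational_polyhedron_def)
  have "\<exists>N::nat. N > 0 \<and> (\<forall>i. real N * (fst r $ i) \<in> \<int>)" if r: "r \<in> R" for r
  proof -
    have "fst r $ i \<in> \<rat>" for i using R(2) r by (auto simp: rational_points_def)
    then show ?thesis using common_denominator[of UNIV "\<lambda>i. fst r $ i"] by (metis UNIV_I finite)
  qed
  then obtain N :: "(real^'n) \<times> real \<Rightarrow> nat" where
    N: "\<And>r. r \<in> R \<Longrightarrow> N r > 0" "\<And>r i. r \<in> R \<Longrightarrow> real (N r) * (fst r $ i) \<in> \<int>" by metis
  have int_inner: "real (N r) * (fst r \<bullet> x) \<in> \<int>" if "r \<in> R" "x \<in> integral_points" for r x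
  proof -
    have "real (N r) * (fst r \<bullet> x) = (\<Sum>i\<in>UNIV. (real (N r) * (fst r $ i)) * x $ i)"
      by (simp add: inner_vec_def sum_distrib_left mult.assoc)
    also have "\<dots> \<in> \<int>" 
    proof (intro Ints_sum)
      fix i
      show "real (N r) * (fst r $ i) * x $ i \<in> \<int>"
        using N(2)[OF that(1), of i] that(2) by (intro Ints_mult[of "real (N r) * (fst r $ i)"]) (simp_all add: integral_points_def)
    qed
    finally show ?thesis .
  qed
  let ?I = "Inl ` R \<union> (\<lambda>i. Inr (i, True)) ` (UNIV :: 'n set) \<union> (\<lambda>i. Inr (i, False)) ` (UNIV :: 'n set)"
  \<comment> \<open>The factor \<open>N r\<close> makes the row integral at integral points, so
    floors and truncation at 0 lose no comparison between points that satisfy the row.\<close>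
  define slack where "slack t r x = nat \<lfloor>t r - real (N r) * (fst r \<bullet> x)\<rfloor>"
    for t and r :: "(real^'n) \<times> real" and x
  define \<phi> :: "((real^'n) \<times> real \<Rightarrow> real) \<Rightarrow> ((real^'n) \<times> real) + ('n \<times> bool) \<Rightarrow> (real^'n) \<Rightarrow> nat"
    where "\<phi> t k x = (case k of Inl r \<Rightarrow> slack t r x
      | Inr (i, s) \<Rightarrow> (if s then nat \<lfloor>x $ i\<rfloor> else nat \<lfloor>- (x $ i)\<rfloor>))" for t k x
  have finI: "finite ?I" using R(1) by simp
  define S where "S = P \<inter> integral_points"
  define M where "M = {x \<in> integral_points. \<forall>r\<in>R. fst r \<bullet> x \<le> 0}"
  have int_diff: "y - x \<in> integral_points" if "x \<in> integral_points" "y \<in> integral_points" for x y :: "real^'n"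
    using that by (auto simp: integral_points_def)
  have slackD: "fst r \<bullet> (y - x) \<le> 0"
    if "r \<in> R" "x \<in> integral_points" "y \<in> integral_points" "slack t r x \<le> slack t r y"
      "real (N r) * (fst r \<bullet> x) \<le> t r" "real (N r) * (fst r \<bullet> y) \<le> t r" for r x y t
  proof -
    note h = that
    obtain k where k: "real (N r) * (fst r \<bullet> x) = of_int k"
      using int_inner[OF h(1,2)] by (rule Ints_cases)
    obtain l where l: "real (N r) * (fst r \<bullet> y) = of_int l"
      using int_inner[OF h(1,3)] by (rule Ints_cases)
    have "l \<le> k" using that(4,5,6) unfolding slack_def k l by linarith
    then have "real (N r) * (fst r \<bullet> (y - x)) \<le> 0"
      by (simp add: inner_diff_right right_diff_distrib k l)
    then show ?thesis using N(1)[OF that(1)] by (simp add: mult_le_0_iff)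
  qed
  obtain F where F: "finite F" "F \<subseteq> S"
    "\<And>y. y \<in> S \<Longrightarrow> \<exists>x\<in>F. \<forall>k\<in>?I. \<phi> (\<lambda>r. real (N r) * snd r) k x \<le> \<phi> (\<lambda>r. real (N r) * snd r) k y"
    by (rule Dickson[OF finI, of S "\<phi> (\<lambda>r. real (N r) * snd r)"]) blast
  obtain G where G: "finite G" "G \<subseteq> M - {0}"
    "\<And>y. y \<in> M - {0} \<Longrightarrow> \<exists>x\<in>G. \<forall>k\<in>?I. \<phi> (\<lambda>r. 0) k x \<le> \<phi> (\<lambda>r. 0) k y"
    by (rule Dickson[OF finI, of "M - {0}" "\<phi> (\<lambda>r. 0)"]) blast
  have M_span: "y \<in> nat_span G" if "y \<in> M" for y
    using that
  proof (induction "nat (\<Sum>i\<in>UNIV. \<lfloor>\<bar>y $ i\<bar>\<rfloor>)" arbitrary: y rule: less_induct)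
    case less
    show ?case
    proof (cases "y = 0")
      case False
      then obtain g where g: "g \<in> G" "\<forall>k\<in>?I. \<phi> (\<lambda>r. 0) k g \<le> \<phi> (\<lambda>r. 0) k y"
        using G(3) less.prems by blast
      have gM: "g \<in> M" "g \<noteq> 0" using g(1) G(2) by auto
      have ints: "g \<in> integral_points" "y \<in> integral_points" using gM less.prems by (auto simp: M_def)
      have "fst r \<bullet> (y - g) \<le> 0" if "r \<in> R" for r
        using that ints gM less.prems bspec[OF g(2), of "Inl r"]
        by (intro slackD[of r g y "\<lambda>r. 0"])
          (auto simp: M_def \<phi>_def mult_nonneg_nonpos)
      then have yg: "y - g \<in> M" using int_diff ints by (auto simp: M_def)
      \<comment> \<open>Domination of positive and negative parts rules out opposite signs, so each
        absolute value drops by exactly that of \<open>g\<close>.\<close>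
      have abs_i: "\<lfloor>\<bar>(y - g) $ i\<bar>\<rfloor> = \<lfloor>\<bar>y $ i\<bar>\<rfloor> - \<lfloor>\<bar>g $ i\<bar>\<rfloor>" for i
      proof -
        have "y $ i \<in> \<int>" using ints by (simp add: integral_points_def)
        then obtain k where k: "y $ i = of_int k" by (rule Ints_cases)
        have "g $ i \<in> \<int>" using ints by (simp add: integral_points_def)
        then obtain l where l: "g $ i = of_int l" by (rule Ints_cases)
        have 1: "nat \<lfloor>g $ i\<rfloor> \<le> nat \<lfloor>y $ i\<rfloor>" using g(2) by (auto simp: \<phi>_def ball_Un)
        have 2: "nat \<lfloor>- g $ i\<rfloor> \<le> nat \<lfloor>- y $ i\<rfloor>" using g(2) by (auto simp: \<phi>_def ball_Un)
        have "\<lfloor>- g $ i\<rfloor> = - l" "\<lfloor>- y $ i\<rfloor> = - k"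
          unfolding k l by (metis floor_of_int of_int_minus)+
        then have "\<bar>k - l\<bar> = \<bar>k\<bar> - \<bar>l\<bar>" using 1 2 unfolding k l by auto
        moreover have "\<bar>(y - g) $ i\<bar> = of_int \<bar>k - l\<bar>" "\<bar>y $ i\<bar> = of_int \<bar>k\<bar>" "\<bar>g $ i\<bar> = of_int \<bar>l\<bar>"
          by (simp_all add: k l)
        ultimately show ?thesis by (simp only: floor_of_int)
      qed
      obtain j where j: "g $ j \<noteq> 0" using gM(2) by (auto simp: vec_eq_iff)
      have "g $ j \<in> \<int>" using ints by (simp add: integral_points_def)
        then obtain l where l: "g $ j = of_int l" by (rule Ints_cases)
      have "\<lfloor>\<bar>g $ j\<bar>\<rfloor> > 0"
        using j unfolding l by (metis abs_ge_zero floor_of_int less_le of_int_abs of_int_0 zero_less_abs_iff)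
      then have pos: "(\<Sum>i\<in>UNIV. \<lfloor>\<bar>g $ i\<bar>\<rfloor>) > 0" by (intro sum_pos2[of _ j]) auto
      have "(\<Sum>i\<in>UNIV. \<lfloor>\<bar>(y - g) $ i\<bar>\<rfloor>) = (\<Sum>i\<in>UNIV. \<lfloor>\<bar>y $ i\<bar>\<rfloor>) - (\<Sum>i\<in>UNIV. \<lfloor>\<bar>g $ i\<bar>\<rfloor>)"
        by (simp only: abs_i sum_subtractf)
      moreover have "0 \<le> (\<Sum>i\<in>UNIV. \<lfloor>\<bar>(y - g) $ i\<bar>\<rfloor>)" by (intro sum_nonneg) auto
      ultimately have "nat (\<Sum>i\<in>UNIV. \<lfloor>\<bar>(y - g) $ i\<bar>\<rfloor>) < nat (\<Sum>i\<in>UNIV. \<lfloor>\<bar>y $ i\<bar>\<rfloor>)"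
        using pos by linarith
      then have "y - g \<in> nat_span G" using less.hyps yg by blast
      then have "(y - g) + g \<in> nat_span G" using nat_span_base G(1) g(1) nat_span_add by blast
      then show ?thesis by simp
    qed (simp add: nat_span_0)
  qed
  have span_M: "nat_span G \<subseteq> M"
  proof
    fix u assume "u \<in> nat_span G"
    then obtain p where u: "u = (\<Sum>g\<in>G. real (p g) *\<^sub>R g)" by (auto simp: nat_span_def)
    have "u $ i \<in> \<int>" for i
      unfolding u using G(2) by (auto simp: M_def integral_points_def intro!: Ints_sum Ints_mult)
    moreover have "fst r \<bullet> u \<le> 0" if "r \<in> R" for r
      unfolding u inner_sum_right using G(2) that
      by (intro sum_nonpos) (auto simp: M_def intro!: mult_nonneg_nonpos)
    ultimately show "u \<in> M" by (auto simp: M_def integral_points_def)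
  qed
  have S_rows: "fst r \<bullet> x \<le> snd r" if "x \<in> S" "r \<in> R" for x r
    using that by (auto simp: S_def P)
  have "S = {f + u |f u. f \<in> F \<and> u \<in> nat_span G}"
  proof (intro equalityI subsetI)
    fix y assume y: "y \<in> S"
    then obtain f where f: "f \<in> F" "\<forall>k\<in>?I. \<phi> (\<lambda>r. real (N r) * snd r) k f \<le> \<phi> (\<lambda>r. real (N r) * snd r) k y"
      using F(3) by blast
    have fS: "f \<in> S" using f(1) F(2) by auto
    have ints: "f \<in> integral_points" "y \<in> integral_points" using y fS by (auto simp: S_def)
    have "fst r \<bullet> (y - f) \<le> 0" if "r \<in> R" for r
      using that ints bspec[OF f(2), of "Inl r"] S_rows[OF y that] S_rows[OF fS that]
      by (intro slackD[of r f y "\<lambda>r. real (N r) * snd r"])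
        (auto simp: \<phi>_def mult_left_mono)
    then have "y - f \<in> M" using int_diff ints by (auto simp: M_def)
    then have "y = f + (y - f)" "y - f \<in> nat_span G" using M_span by auto
    then show "y \<in> {f + u |f u. f \<in> F \<and> u \<in> nat_span G}" using f(1) by blast
  next
    fix y assume "y \<in> {f + u |f u. f \<in> F \<and> u \<in> nat_span G}"
    then obtain f u where fu: "y = f + u" "f \<in> S" "u \<in> M" using F(2) span_M by blast
    have "a \<bullet> (f + u) \<le> b" if "(a, b) \<in> R" for a b
      using S_rows[OF fu(2) that] fu(3) that by (force simp: M_def inner_add_right)
    then show "y \<in> S" using fu by (auto simp: S_def P M_def integral_points_def)
  qed
  then show ?thesis using that[OF F(1) G(1)] G(2) by (auto simp: S_def M_def)
qed

section \<open>Finitely generated monoids modulo a subspace\<close>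

lemma convex_cone_hull_finite:
  fixes G :: "'a::real_vector set"
  assumes "finite G"
  shows "convex_cone hull G = {\<Sum>g\<in>G. c g *\<^sub>R g |c. \<forall>g\<in>G. 0 \<le> c g}" (is "_ = ?R")
proof
  have sub: "x \<in> ?R" if "x \<in> G" for x
    using that assms by (intro CollectI exI[of _ "\<lambda>g. if g = x then 1 else 0"])
      (simp add: if_distrib[of "\<lambda>c. c *\<^sub>R _"] cong: if_cong)
  have "convex_cone ?R"
    unfolding convex_cone_iff
  proof (intro conjI ballI allI impI)
    show "0 \<in> ?R" by (intro CollectI exI[of _ "\<lambda>g. 0"]) simp
  next
    fix x y assume "x \<in> ?R" "y \<in> ?R"
    then obtain c d where "x = (\<Sum>g\<in>G. c g *\<^sub>R g)" "y = (\<Sum>g\<in>G. d g *\<^sub>R g)"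
      "\<forall>g\<in>G. 0 \<le> c g" "\<forall>g\<in>G. 0 \<le> d g" by auto
    then show "x + y \<in> ?R"
      by (intro CollectI exI[of _ "\<lambda>g. c g + d g"]) (simp add: scaleR_left_distrib sum.distrib)
  next
    fix x and t :: real assume "x \<in> ?R" "0 \<le> t"
    then obtain c where "x = (\<Sum>g\<in>G. c g *\<^sub>R g)" "\<forall>g\<in>G. 0 \<le> c g" by auto
    with \<open>0 \<le> t\<close> show "t *\<^sub>R x \<in> ?R"
      by (intro CollectI exI[of _ "\<lambda>g. t * c g"]) (simp add: scaleR_sum_right)
  qed
  then show "convex_cone hull G \<subseteq> ?R" using sub by (intro hull_minimal) auto
  show "?R \<subseteq> convex_cone hull G"
  proof
    fix x assume "x \<in> ?R"
    then obtain c where c: "x = (\<Sum>g\<in>G. c g *\<^sub>R g)" "\<forall>g\<in>G. 0 \<le> c g" by auto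
    have "(\<Sum>g\<in>G'. c g *\<^sub>R g) \<in> convex_cone hull G" if "finite G'" "G' \<subseteq> G" for G'
      using that
      by (induction G') (use c(2) in \<open>auto simp: convex_cone_hull_contains_0 hull_inc
            intro!: convex_cone_hull_add convex_cone_hull_mul\<close>)
    from this[OF assms] show "x \<in> convex_cone hull G" using c(1) by simp
  qed
qed

lemma nat_span_subset_cone: "finite G \<Longrightarrow> nat_span G \<subseteq> convex_cone hull G"
  unfolding nat_span_def convex_cone_hull_finite by (auto intro!: exI)

text \<open>Dirichlet's theorem bounds the denominator only from above. Applying it to the multiples
  \<open>N' * c\<close> and absorbing \<open>N'\<close> into the denominator makes the latter at
  least \<open>N\<close>. The numerators are nonnegative because they are integers above -1.\<close>

lemma simultaneous_approximation:
  fixes c :: "'a \<Rightarrow> real"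
  assumes "finite G" "\<And>g. g \<in> G \<Longrightarrow> 0 \<le> c g" "0 < e"
  obtains q :: nat and p :: "'a \<Rightarrow> nat"
  where "N \<le> q" "0 < q" "\<And>g. g \<in> G \<Longrightarrow> \<bar>real (p g) - real q * c g\<bar> < e"
proof -
  define N' where "N' = max N 1"
  obtain h where h: "bij_betw h {0..<card G} G"
    using assms(1) ex_bij_betw_nat_finite by blast
  obtain m :: nat where m: "inverse (real (Suc m)) < e"
    using reals_Archimedean[OF assms(3)] by auto
  obtain q p where q: "0 < (q::int)"
    and qp: "\<And>i. i < card G \<Longrightarrow> \<bar>of_int q * (real N' * c (h i)) - of_int (p i)\<bar> < 1 / Suc m"
    by (rule Dirichlet_approx_simult[of "Suc m" "card G" "\<lambda>i. real N' * c (h i)"]) auto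
  define p' where "p' g = nat (p (inv_into {0..<card G} h g))" for g
  have "\<bar>real (p' g) - real (nat q * N') * c g\<bar> < e" if g: "g \<in> G" for g
  proof -
    define i where "i = inv_into {0..<card G} h g"
    have i: "i < card G" "h i = g"
      using bij_betw_inv_into_right[OF h g] bij_betwE[OF bij_betw_inv_into[OF h]] g by (auto simp: i_def)
    have b: "\<bar>of_int q * (real N' * c g) - of_int (p i)\<bar> < 1 / Suc m"
      using qp[OF i(1)] i(2) by simp
    have "0 \<le> of_int q * (real N' * c g)" using q assms(2)[OF g] by simp
    moreover have "1 / Suc m \<le> (1::real)" by simp
    ultimately have "(-1::real) < of_int (p i)" using b by linarith
    then have "0 \<le> p i" by linarith
    then have "real (p' g) = of_int (p i)" by (simp add: p'_def i_def)
    moreover have "real (nat q) = of_int q" using q by simp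
    then have "real (nat q * N') * c g = of_int q * (real N' * c g)" by (simp only: of_nat_mult mult.assoc)
    moreover have "1 / Suc m < e" using m by (simp add: inverse_eq_divide)
    ultimately show ?thesis using b by (simp only: abs_minus_commute)
  qed
  moreover have "1 \<le> nat q" using q by linarith
  then have "N' \<le> nat q * N'" using mult_le_mono1[of 1 "nat q" N'] by simp
  moreover have "N \<le> N'" "0 < N'" by (auto simp: N'_def)
  ultimately show ?thesis using that[of "nat q * N'" p'] by (meson less_le_trans order_trans)
qed

lemma norm_weighted_sum_le:
  assumes "finite G" "\<And>g. g \<in> G \<Longrightarrow> \<bar>c g\<bar> \<le> e"
  shows "norm (\<Sum>g\<in>G. c g *\<^sub>R f g) \<le> e * (\<Sum>g\<in>G. norm (f g))"
proof -
  have "norm (\<Sum>g\<in>G. c g *\<^sub>R f g) \<le> (\<Sum>g\<in>G. norm (c g *\<^sub>R f g))" by (rule norm_sum)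
  also have "\<dots> \<le> (\<Sum>g\<in>G. e * norm (f g))"
    using assms(2) by (intro sum_mono) (simp add: mult_right_mono)
  finally show ?thesis by (simp add: sum_distrib_left)
qed

text \<open>\<open>\<pi>\<close> is a linear projection with kernel \<open>L\<close>. It is left
  abstract because hyperplanes use an explicit formula and lineality spaces an orthonormal
  basis.\<close>

locale monoid_mod_subspace =
  fixes G L :: "'a::euclidean_space set" and \<pi> :: "'a \<Rightarrow> 'a"
  assumes finG: "finite G"
    and subL: "subspace L"
    and lin: "linear \<pi>"
    and diff_L: "\<And>x. x - \<pi> x \<in> L"
    and \<pi>_L: "\<And>x. x \<in> L \<Longrightarrow> \<pi> x = 0"
begin

abbreviation "M \<equiv> nat_span G"
abbreviation "K \<equiv> convex_cone hull G"
text \<open>An open set invariant under translation by \<open>L\<close> that misses all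
  \<open>s + m\<close> with \<open>m \<in> M\<close> misses all \<open>s + x\<close> with
  \<open>x \<in> A\<close>. This is how limits of \<open>M + L\<close> obstruct free sets.\<close>

definition "A = closure {m + l |m l. m \<in> M \<and> l \<in> L}"

text \<open>The condition \<open>- u \<in> A\<close> says that \<open>u\<close> is invertible in the
  closure of \<open>M + L\<close>; it provides both directions of the line when discreteness
  fails.\<close>

definition discrete_mod :: bool where
  "discrete_mod \<longleftrightarrow> (\<exists>e>0. \<forall>u\<in>M. - u \<in> A \<longrightarrow> norm (\<pi> u) < e \<longrightarrow> u \<in> L)"

lemma \<pi>_eq_0: "\<pi> x = 0 \<longleftrightarrow> x \<in> L"
  using \<pi>_L diff_L[of x] by auto

lemma \<pi>_idem: "\<pi> (\<pi> x) = \<pi> x"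
  using \<pi>_L[OF diff_L[of x]] lin by (simp add: linear_diff)

lemma \<pi>_sum: "\<pi> (\<Sum>g\<in>G. c g *\<^sub>R g) = (\<Sum>g\<in>G. c g *\<^sub>R \<pi> g)"
  by (simp add: linear_sum[OF lin] linear_cmul[OF lin])

lemma A_I: "m \<in> M \<Longrightarrow> l \<in> L \<Longrightarrow> m + l \<in> A"
  unfolding A_def by (rule subsetD[OF closure_subset]) auto

lemma A_addition:
  assumes "x \<in> A" "y \<in> A" shows "x + y \<in> A"
proof -
  let ?T = "{m + l |m l. m \<in> M \<and> l \<in> L}"
  obtain f where f: "\<And>n. f n \<in> ?T" "f \<longlonglongrightarrow> x"
    using assms(1) unfolding A_def closure_sequential by blast
  obtain g where g: "\<And>n. g n \<in> ?T" "g \<longlonglongrightarrow> y"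
    using assms(2) unfolding A_def closure_sequential by blast
  have "f n + g n \<in> ?T" for n
  proof -
    obtain m l m' l' where "f n = m + l" "g n = m' + l'" "m \<in> M" "m' \<in> M" "l \<in> L" "l' \<in> L"
      using f(1)[of n] g(1)[of n] by blast
    then show ?thesis
      using nat_span_add subspace_add[OF subL]
      by (intro CollectI exI[of _ "m + m'"] exI[of _ "l + l'"]) simp
  qed
  then show ?thesis
    unfolding A_def closure_sequential using tendsto_add[OF f(2) g(2)]
    by (intro exI[of _ "\<lambda>n. f n + g n"]) blast
qed

lemma L_subset_A: "l \<in> L \<Longrightarrow> l \<in> A"
  using A_I[OF nat_span_0] by simp

lemma M_subset_A: "m \<in> M \<Longrightarrow> m \<in> A"
  using A_I[OF _ subspace_0[OF subL]] by simp

lemma A_multiple: "x \<in> A \<Longrightarrow> real n *\<^sub>R x \<in> A"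
  by (induction n) (auto simp: scaleR_left_distrib A_addition L_subset_A subspace_0[OF subL])

text \<open>If \<open>w\<close> has the coefficients \<open>c\<close>, then \<open>p' - p\<close> has nonnegative entries for every good
  simultaneous approximation \<open>p' / q\<close> of \<open>c\<close> with large \<open>q\<close>, and it represents \<open>q w - u\<close>
  up to a small error.\<close>

lemma reversible:
  assumes c: "\<And>g. g \<in> G \<Longrightarrow> 0 \<le> c g" "(\<Sum>g\<in>G. c g *\<^sub>R g) \<in> L"
    and p: "\<And>g. g \<in> G \<Longrightarrow> c g = 0 \<Longrightarrow> p g = (0::nat)"
  shows "- (\<Sum>g\<in>G. real (p g) *\<^sub>R g) \<in> A"
  unfolding A_def closure_approachable
proof (intro allI impI)
  fix e :: real assume "0 < e"
  define C where "C = (\<Sum>g\<in>G. norm g) + 1"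
  have "C > 0" by (simp add: C_def add_nonneg_pos sum_nonneg)
  \<comment> \<open>The bound 1 serves the comparison of the coefficients, the bound
    \<open>e / C\<close> the distance of the resulting vector.\<close>
  define \<delta> where "\<delta> = min 1 (e / C)"
  have "\<delta> > 0" using \<open>0 < e\<close> \<open>C > 0\<close> by (simp add: \<delta>_def)
  \<comment> \<open>With \<open>q\<close> at least this sum, \<open>q * c g\<close> is at least
    \<open>p g + 1\<close> on the support of \<open>c\<close>; the extra 1 absorbs the approximation
    error.\<close>
  define N where "N = nat \<lceil>\<Sum>g\<in>G. (if c g = 0 then 0 else (real (p g) + 1) / c g)\<rceil>"
  obtain q p' where q: "N \<le> q" "\<And>g. g \<in> G \<Longrightarrow> \<bar>real (p' g) - real q * c g\<bar> < \<delta>"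
    by (rule simultaneous_approximation[OF finG _ \<open>\<delta> > 0\<close>, where N = N and c = c]) (use c(1) in auto)
  have le: "p g \<le> p' g" if g: "g \<in> G" for g
  proof (cases "c g = 0")
    case False
    then have cg: "c g > 0" using c(1)[OF g] by simp
    have "(real (p g) + 1) / c g \<le> (\<Sum>g\<in>G. (if c g = 0 then 0 else (real (p g) + 1) / c g))"
      using member_le_sum[of g G "\<lambda>g. (if c g = 0 then 0 else (real (p g) + 1) / c g)"] c(1) finG g False
      by auto
    also have "\<dots> \<le> real q" using q(1) unfolding N_def by linarith
    finally have "real (p g) + 1 \<le> real q * c g" using cg by (simp add: field_simps)
    then show ?thesis using q(2)[OF g] by (simp add: \<delta>_def abs_less_iff)
  qed (use p g in simp)
  let ?m = "\<Sum>g\<in>G. real (p' g - p g) *\<^sub>R g" and ?l = "- (real q *\<^sub>R (\<Sum>g\<in>G. c g *\<^sub>R g))"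
  have "?m + ?l + (\<Sum>g\<in>G. real (p g) *\<^sub>R g) = (\<Sum>g\<in>G. (real (p' g) - real q * c g) *\<^sub>R g)"
    using le by (simp add: of_nat_diff scaleR_left_diff_distrib sum_subtractf scaleR_sum_right)
  moreover have "norm (\<Sum>g\<in>G. (real (p' g) - real q * c g) *\<^sub>R g) \<le> \<delta> * (\<Sum>g\<in>G. norm g)"
    using norm_weighted_sum_le[OF finG, of _ \<delta> "\<lambda>g. g"] q(2) by (simp add: less_imp_le)
  moreover have "\<delta> * (\<Sum>g\<in>G. norm g) < e"
  proof -
    have "\<delta> * (\<Sum>g\<in>G. norm g) < \<delta> * C" using \<open>\<delta> > 0\<close> by (simp add: C_def)
    also have "\<dots> \<le> e / C * C" using \<open>C > 0\<close> by (intro mult_right_mono) (auto simp: \<delta>_def)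
    finally show ?thesis using \<open>C > 0\<close> by simp
  qed
  ultimately have "dist (?m + ?l) (- (\<Sum>g\<in>G. real (p g) *\<^sub>R g)) < e"
    by (simp add: dist_norm)
  moreover have "?m \<in> M" by (rule nat_spanI)
  moreover have "?l \<in> L" using subL c(2) by (simp add: subspace_neg subspace_scale)
  ultimately show "\<exists>y\<in>{m + l |m l. m \<in> M \<and> l \<in> L}. dist y (- (\<Sum>g\<in>G. real (p g) *\<^sub>R g)) < e"
    by blast
qed

lemma closed_A: "closed A" by (simp add: A_def)

text \<open>The unit directions of ever smaller invertible elements accumulate at some
  \<open>d\<close>. Integer multiples of such small steps are arbitrarily fine along
  \<open>d\<close>, and \<open>A\<close> is closed under addition and limits.\<close>

lemma line_of_tiny:
  assumes "\<not> discrete_mod"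
  obtains d where "d \<notin> L" "\<And>t. t *\<^sub>R d \<in> A"
proof -
  have "\<forall>n. \<exists>u. u \<in> M \<and> - u \<in> A \<and> norm (\<pi> u) < inverse (real (Suc n)) \<and> u \<notin> L"
    using assms unfolding discrete_mod_def by (metis inverse_positive_iff_positive of_nat_0_less_iff zero_less_Suc)
  then obtain u where u: "\<And>n. u n \<in> M" "\<And>n. - u n \<in> A"
    "\<And>n. norm (\<pi> (u n)) < inverse (real (Suc n))" "\<And>n. u n \<notin> L" by metis
  define v where "v n = \<pi> (u n)" for n
  have v0: "v n \<noteq> 0" for n using u(4) \<pi>_eq_0 by (simp add: v_def)
  have vA: "v n \<in> A" "- v n \<in> A" for n
  proof -
    have "- (u n - v n) \<in> L" unfolding v_def by (intro subspace_neg[OF subL] diff_L)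
    from A_addition[OF M_subset_A[OF u(1)[of n]] L_subset_A[OF this]]
    show "v n \<in> A" by simp
    from A_addition[OF u(2)[of n] L_subset_A[OF diff_L[of "u n"]]]
    show "- v n \<in> A" by (simp add: v_def)
  qed
  have vlim: "v \<longlonglongrightarrow> 0"
  proof (rule Lim_null_comparison)
    show "\<forall>\<^sub>F n in sequentially. norm (v n) \<le> inverse (real (Suc n))"
      using u(3) by (intro always_eventually) (auto simp: v_def less_imp_le)
    show "(\<lambda>n. inverse (real (Suc n))) \<longlonglongrightarrow> 0" by (rule LIMSEQ_inverse_real_of_nat)
  qed
  define e where "e n = v n /\<^sub>R norm (v n)" for n
  have "\<forall>n. e n \<in> sphere 0 1" using v0 by (auto simp: e_def)
  then obtain d r where d: "d \<in> sphere 0 1" "strict_mono (r::nat\<Rightarrow>nat)" "(e \<circ> r) \<longlonglongrightarrow> d"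
    using compact_sphere[of "0::'a" 1] unfolding compact_def by metis
  then have er: "(\<lambda>n. e (r n)) \<longlonglongrightarrow> d" by (simp add: o_def)
  \<comment> \<open>\<open>\<pi>\<close> fixes the vectors \<open>e n\<close> and hence their limit
    \<open>d\<close>; a nonzero fixed vector is outside the kernel \<open>L\<close>.\<close>
  have "\<pi> (e n) = e n" for n using \<pi>_idem by (simp add: e_def v_def linear_cmul[OF lin])
  moreover have "(\<lambda>n. \<pi> (e (r n))) \<longlonglongrightarrow> \<pi> d"
    using er lin by (intro isCont_tendsto_compose[of _ \<pi>] linear_continuous_at) (auto simp: linear_conv_bounded_linear)
  ultimately have "(\<lambda>n. e (r n)) \<longlonglongrightarrow> \<pi> d" by simp
  from LIMSEQ_unique[OF this er] have "\<pi> d = d" .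
  then have dL: "d \<notin> L" using d(1) \<pi>_L[of d] by (metis mem_sphere_0 norm_zero zero_neq_one)
  have pos: "t *\<^sub>R (s *\<^sub>R d) \<in> A" if "t \<ge> 0" "\<bar>s\<bar> = 1" for t s
  proof -
    have sv: "s *\<^sub>R v n \<in> A" for n
      using vA[of n] that(2) by (auto simp: abs_if split: if_splits)
    \<comment> \<open>The number of steps of length \<open>norm (v n)\<close> that fit into
      \<open>t\<close>; the remainder is shorter than one step.\<close>
    define k where "k n = nat \<lfloor>t / norm (v n)\<rfloor>" for n
    have "\<bar>real (k n) * norm (v n) - t\<bar> \<le> norm (v n)" for n
    proof -
      have "t / norm (v n) - 1 \<le> real (k n)" "real (k n) \<le> t / norm (v n)"
        using that(1) by (auto simp: k_def)
      then show ?thesis using v0[of n] by (auto simp: field_simps abs_le_iff)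
    qed
    then have "\<forall>\<^sub>F n in sequentially. norm (real (k n) * norm (v n) - t) \<le> norm (v n)"
      unfolding real_norm_def by (intro always_eventually allI)
    then have "(\<lambda>n. real (k n) * norm (v n) - t) \<longlonglongrightarrow> 0"
      by (rule Lim_null_comparison[OF _ tendsto_norm_zero[OF vlim]])
    then have "(\<lambda>n. real (k n) * norm (v n)) \<longlonglongrightarrow> t" by (simp only: LIM_zero_iff)
    from LIMSEQ_subseq_LIMSEQ[OF this d(2)]
    have tl: "(\<lambda>n. real (k (r n)) * norm (v (r n))) \<longlonglongrightarrow> t" by (simp only: o_def)
    have "(\<lambda>n. (real (k (r n)) * norm (v (r n))) *\<^sub>R (s *\<^sub>R e (r n))) \<longlonglongrightarrow> t *\<^sub>R (s *\<^sub>R d)"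
      by (intro tendsto_intros tl er)
    moreover have "(real (k (r n)) * norm (v (r n))) *\<^sub>R (s *\<^sub>R e (r n)) = real (k (r n)) *\<^sub>R (s *\<^sub>R v (r n))" for n
      using v0 by (simp add: e_def)
    ultimately have "(\<lambda>n. real (k (r n)) *\<^sub>R (s *\<^sub>R v (r n))) \<longlonglongrightarrow> t *\<^sub>R (s *\<^sub>R d)" by simp
    then show ?thesis
      by (rule closed_sequentially[OF closed_A, rotated]) (rule A_multiple[OF sv])
  qed
  have "t *\<^sub>R d \<in> A" for t
    using pos[of t 1] pos[of "- t" "-1"] by (cases "t \<ge> 0") auto
  with dL show ?thesis using that by blast
qed

text \<open>Equivalently, the generators that occur with a positive coefficient in some representation
  of an element of \<open>L \<inter> K\<close>.\<close>

definition good where "good = {g \<in> G. - \<pi> g \<in> \<pi> ` K}"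

lemma good_in_kernel:
  assumes "g \<in> good"
  obtains c where "\<And>h. h \<in> G \<Longrightarrow> 0 \<le> c h" "0 < c g" "(\<Sum>h\<in>G. c h *\<^sub>R h) \<in> L"
proof -
  obtain k where k: "k \<in> K" "- \<pi> g = \<pi> k" and g: "g \<in> G" using assms by (auto simp: good_def)
  obtain c where c: "k = (\<Sum>h\<in>G. c h *\<^sub>R h)" "\<And>h. h \<in> G \<Longrightarrow> 0 \<le> c h"
    using k(1) by (auto simp: convex_cone_hull_finite[OF finG])
  have "\<pi> (g + k) = 0" using k(2) by (simp add: linear_add[OF lin] flip: k(2))
  then have "g + k \<in> L" by (simp add: \<pi>_eq_0)
  moreover have "g = (\<Sum>h\<in>G. (if h = g then 1 else 0) *\<^sub>R h)"
    using finG g by (simp add: if_distrib[of "\<lambda>c. c *\<^sub>R _"] cong: if_cong)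
  then have "g + k = (\<Sum>h\<in>G. ((if h = g then 1 else 0) + c h) *\<^sub>R h)"
    unfolding c(1) scaleR_left_distrib sum.distrib by simp
  ultimately show ?thesis
    using c(2) g by (intro that[of "\<lambda>h. (if h = g then 1 else 0) + c h"])
      (auto simp: add_pos_nonneg)
qed

text \<open>Every good generator has its own representation of a point of \<open>L\<close> with a
  positive coefficient, so it is invertible in \<open>A\<close>; addition in \<open>A\<close>
  extends this to sums.\<close>

lemma good_sum_reversible:
  assumes "\<And>g. g \<in> G \<Longrightarrow> g \<notin> good \<Longrightarrow> p g = (0::nat)"
  shows "- (\<Sum>g\<in>G. real (p g) *\<^sub>R g) \<in> A"
proof -
  have base: "- g \<in> A" if gg: "g \<in> good" for g
  proof -
    obtain c where c: "\<And>h. h \<in> G \<Longrightarrow> 0 \<le> c h" "0 < c g" "(\<Sum>h\<in>G. c h *\<^sub>R h) \<in> L"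
      using good_in_kernel[OF gg] by blast
    have "- (\<Sum>h\<in>G. real (if h = g then 1 else 0) *\<^sub>R h) \<in> A"
      using c by (intro reversible[of c]) auto
    moreover have "g \<in> G" using that by (simp add: good_def)
    ultimately show ?thesis
      using finG by (simp add: if_distrib[of real] if_distrib[of "\<lambda>c. c *\<^sub>R _"] cong: if_cong)
  qed
  have "(\<Sum>g\<in>H. real (p g) *\<^sub>R (- g)) \<in> A" if "finite H" "H \<subseteq> G" for H
    using that
  proof (induction H)
    case (insert h H)
    have "real (p h) *\<^sub>R (- h) \<in> A"
    proof (cases "h \<in> good")
      case True
      then show ?thesis using A_multiple[OF base] by blast
    qed (use assms insert.prems L_subset_A subspace_0[OF subL] in auto)
    moreover have "(\<Sum>g\<in>H. real (p g) *\<^sub>R (- g)) \<in> A" using insert by blast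
    ultimately show ?case
      unfolding sum.insert[OF insert.hyps(1,2)] by (rule A_addition)
  qed (use L_subset_A subspace_0[OF subL] in auto)
  from this[OF finG] show ?thesis by (simp add: sum_negf)
qed

end

section \<open>The projected cone and the consequences of discreteness\<close>

context monoid_mod_subspace
begin

lemma \<pi>_K: "\<pi> ` K = convex_cone hull (\<pi> ` G)"
  using convex_cone_hull_linear_image[OF lin] by simp

lemma \<pi>_K_closed: "closed (\<pi> ` K)"
  unfolding \<pi>_K using finG by (intro closed_convex_cone_hull) simp

lemma \<pi>_K_add: "x \<in> \<pi> ` K \<Longrightarrow> y \<in> \<pi> ` K \<Longrightarrow> x + y \<in> \<pi> ` K"
  unfolding \<pi>_K by (rule convex_cone_hull_add)

lemma \<pi>_K_scale: "x \<in> \<pi> ` K \<Longrightarrow> 0 \<le> t \<Longrightarrow> t *\<^sub>R x \<in> \<pi> ` K"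
  unfolding \<pi>_K by (rule convex_cone_hull_mul)

text \<open>Isolates one generator: after division by its coefficient, \<open>- \<pi> g\<close> is a
  point of the cone up to the vector \<open>v / p g\<close>. That vector is compensated if
  \<open>- v\<close> lies in the cone, and it vanishes in the limit if \<open>v\<close> is bounded
  and the coefficient grows.\<close>

lemma \<pi>_coeff_K:
  assumes "g \<in> G" "\<pi> (\<Sum>h\<in>G. real (p h) *\<^sub>R h) = v" "0 < p g"
  shows "(1 / real (p g)) *\<^sub>R v - \<pi> g \<in> \<pi> ` K"
proof -
  have "v = real (p g) *\<^sub>R \<pi> g + (\<Sum>h\<in>G - {g}. real (p h) *\<^sub>R \<pi> h)"
    using assms(2) sum.remove[OF finG assms(1), of "\<lambda>h. real (p h) *\<^sub>R \<pi> h"] by (simp only: \<pi>_sum)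
  then have "(1 / real (p g)) *\<^sub>R v - \<pi> g = (1 / real (p g)) *\<^sub>R (\<Sum>h\<in>G - {g}. real (p h) *\<^sub>R \<pi> h)"
    using assms(3) by (simp add: scaleR_right_distrib)
  also have "(\<Sum>h\<in>G - {g}. real (p h) *\<^sub>R \<pi> h) = \<pi> (\<Sum>h\<in>G. real (if h = g then 0 else p h) *\<^sub>R h)"
    unfolding \<pi>_sum by (intro sum.mono_neutral_cong_left finG) auto
  also have "(1 / real (p g)) *\<^sub>R \<dots> \<in> \<pi> ` K"
    using nat_span_subset_cone[OF finG] nat_spanI[of "\<lambda>h. if h = g then 0 else p h" G]
    by (intro \<pi>_K_scale imageI) auto
  finally show ?thesis .
qed

lemma \<pi>_A_subset: "x \<in> A \<Longrightarrow> \<pi> x \<in> \<pi> ` K"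
proof -
  assume "x \<in> A"
  have "\<pi> ` {m + l |m l. m \<in> M \<and> l \<in> L} \<subseteq> \<pi> ` K"
    using nat_span_subset_cone[OF finG] by (auto simp: linear_add[OF lin] \<pi>_L)
  then have "\<pi> ` closure {m + l |m l. m \<in> M \<and> l \<in> L} \<subseteq> \<pi> ` K"
    using lin \<pi>_K_closed
    by (intro image_closure_subset) (auto simp: linear_continuous_on linear_conv_bounded_linear)
  then show ?thesis using \<open>x \<in> A\<close> by (auto simp: A_def)
qed

text \<open>The converse of \<open>good_sum_reversible\<close>: both \<open>- \<pi> u\<close> and
  the part of \<open>\<pi> u\<close> without \<open>g\<close> lie in the projected cone, and
  suitably scaled they add up to \<open>- \<pi> g\<close>.\<close>

lemma reversible_support_good:
  assumes "- (\<Sum>h\<in>G. real (p h) *\<^sub>R h) \<in> A" "g \<in> G" "0 < p g"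
  shows "g \<in> good"
proof -
  let ?u = "\<Sum>h\<in>G. real (p h) *\<^sub>R h"
  have "- \<pi> ?u \<in> \<pi> ` K" using \<pi>_A_subset[OF assms(1)] by (simp add: linear_neg[OF lin])
  from \<pi>_K_add[OF \<pi>_K_scale[OF this, of "1 / real (p g)"] \<pi>_coeff_K[of g p, OF assms(2) refl assms(3)]]
  show ?thesis using assms(2) by (simp add: good_def)
qed

text \<open>From infinitely many projections in a ball a convergent subsequence with increasing
  coefficients is taken. Coefficients of generators that are not good stay bounded, hence become
  constant. Differences of consecutive terms then involve good generators only, so they are
  invertible elements of \<open>M\<close> with small projections; discreteness puts them into
  \<open>L\<close>, although the projections are distinct.\<close>

lemma finite_mod:
  assumes discrete_mod
  shows "finite (\<pi> ` M \<inter> cball 0 R)"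
proof (rule ccontr)
  assume "infinite (\<pi> ` M \<inter> cball 0 R)"
  then obtain v :: "nat \<Rightarrow> 'a" where v: "inj v" "range v \<subseteq> \<pi> ` M \<inter> cball 0 R"
    using infinite_countable_subset by blast
  have "\<forall>n. \<exists>p. v n = \<pi> (\<Sum>g\<in>G. real (p g) *\<^sub>R g)"
    using v(2) unfolding nat_span_def by blast
  then obtain p where p: "\<And>n. v n = \<pi> (\<Sum>g\<in>G. real (p n g) *\<^sub>R g)" by metis
  have "\<forall>n. v n \<in> cball 0 R" using v(2) by blast
  then obtain l r1 where r1: "strict_mono (r1::nat\<Rightarrow>nat)" "(v \<circ> r1) \<longlonglongrightarrow> l"
    using compact_cball[of "0::'a" R] unfolding compact_def by metis
  obtain r2 :: "nat \<Rightarrow> nat" where r2: "strict_mono r2" "\<forall>g\<in>G. mono ((\<lambda>n. p (r1 n) g) \<circ> r2)"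
    using mono_subsequence_nat_family[OF finG, of "\<lambda>g n. p (r1 n) g"] by blast
  define w where "w n = v (r1 (r2 n))" for n
  define P where "P g n = p (r1 (r2 n)) g" for g n
  have wP: "w n = \<pi> (\<Sum>g\<in>G. real (P g n) *\<^sub>R g)" for n by (simp add: w_def P_def p)
  have wl: "w \<longlonglongrightarrow> l" using LIMSEQ_subseq_LIMSEQ[OF r1(2) r2(1)] by (simp add: w_def[abs_def] o_def)
  have "v m \<in> cball 0 R" for m using v(2) by blast
  then have wR: "norm (w n) \<le> R" for n by (simp add: w_def)
  have w_inj: "w (Suc n) \<noteq> w n" for n
    unfolding w_def inj_eq[OF v(1)] strict_mono_eq[OF r1(1)] strict_mono_eq[OF r2(1)] by simp
  have P_mono: "mono (P g)" if "g \<in> G" for g using r2(2) that by (auto simp: P_def mono_def)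
  have bdd: "\<exists>B. \<forall>n. P g n \<le> B" if g: "g \<in> G - good" for g
  proof (rule ccontr)
    assume "\<not> ?thesis"
    then have "\<forall>k. \<exists>n. k < P g n" by (metis not_le)
    then obtain n where n: "\<And>k. k < P g (n k)" by metis
    \<comment> \<open>Division by a coefficient exceeding \<open>k\<close> sends the bounded vectors
      \<open>w (n k)\<close> to 0, so these points of the closed cone tend to
      \<open>- \<pi> g\<close>.\<close>
    define k' where "k' k = (1 / real (P g (n k))) *\<^sub>R w (n k) - \<pi> g" for k
    have "k' k \<in> \<pi> ` K" for k
    proof -
      have "0 < P g (n k)" using n[of k] by simp
      with \<pi>_coeff_K[of g "\<lambda>g. P g (n k)", OF _ wP[symmetric]] g show ?thesis by (simp add: k'_def)
    qed
    moreover have "k' \<longlonglongrightarrow> - \<pi> g"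
    proof -
      have "norm ((1 / real (P g (n k))) *\<^sub>R w (n k)) \<le> R * inverse (real (Suc k))" for k
      proof -
        have "real (Suc k) \<le> real (P g (n k))" using n[of k] by simp
        then have "1 / real (P g (n k)) \<le> inverse (real (Suc k))"
          unfolding inverse_eq_divide by (intro divide_left_mono) auto
        then have "1 / real (P g (n k)) * norm (w (n k)) \<le> inverse (real (Suc k)) * R"
          using wR by (intro mult_mono) auto
        then show ?thesis by (simp add: mult.commute)
      qed
      then have "\<forall>\<^sub>F k in sequentially. norm ((1 / real (P g (n k))) *\<^sub>R w (n k)) \<le> R * inverse (real (Suc k))"
        by (intro always_eventually allI)
      moreover have "(\<lambda>k. R * inverse (real (Suc k))) \<longlonglongrightarrow> 0"
        using tendsto_mult_right_zero[OF LIMSEQ_inverse_real_of_nat] .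
      ultimately have "(\<lambda>k. (1 / real (P g (n k))) *\<^sub>R w (n k)) \<longlonglongrightarrow> 0"
        by (rule Lim_null_comparison)
      from tendsto_diff[OF this tendsto_const[of "\<pi> g"]] show ?thesis by (simp add: k'_def[abs_def])
    qed
    ultimately have "- \<pi> g \<in> \<pi> ` K" by (rule closed_sequentially[OF \<pi>_K_closed])
    then show False using g by (simp add: good_def)
  qed
  have "\<exists>c. \<forall>\<^sub>F n in sequentially. P g n = c" if g: "g \<in> G - good" for g
  proof -
    obtain B where B: "\<And>n. P g n \<le> B" using bdd[OF g] by blast
    have "mono (P g)" using g P_mono by blast
    from eventually_const_of_mono_bounded[OF this B]
    obtain N where "\<And>n. N \<le> n \<Longrightarrow> P g n = P g N" by metis
    then show ?thesis unfolding eventually_sequentially by blast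
  qed
  then obtain c where c: "\<And>g. g \<in> G - good \<Longrightarrow> \<forall>\<^sub>F n in sequentially. P g n = c g" by metis
  have ev1: "\<forall>\<^sub>F n in sequentially. \<forall>g\<in>G - good. P g n = c g"
    using finG c by (intro eventually_ball_finite) auto
  have ev2: "\<forall>\<^sub>F n in sequentially. \<forall>g\<in>G - good. P g (Suc n) = c g"
    using ev1 by (rule eventually_sequentially_Suc[THEN iffD2])
  obtain e where e: "0 < e" "\<And>u. u \<in> M \<Longrightarrow> - u \<in> A \<Longrightarrow> norm (\<pi> u) < e \<Longrightarrow> u \<in> L"
    using assms unfolding discrete_mod_def by blast
  have "(\<lambda>n. w (Suc n) - w n) \<longlonglongrightarrow> l - l"
    using LIMSEQ_Suc[OF wl] wl by (rule tendsto_diff)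
  then have "\<forall>\<^sub>F n in sequentially. dist (w (Suc n) - w n) 0 < e"
    using e(1) by (intro tendstoD) auto
  then have "\<forall>\<^sub>F n in sequentially. dist (w (Suc n) - w n) 0 < e
      \<and> (\<forall>g\<in>G - good. P g n = c g) \<and> (\<forall>g\<in>G - good. P g (Suc n) = c g)"
    using ev1 ev2 by (intro eventually_conj)
  then obtain n where n: "norm (w (Suc n) - w n) < e" "\<And>g. g \<in> G - good \<Longrightarrow> P g (Suc n) = P g n"
    unfolding eventually_sequentially by fastforce
  \<comment> \<open>The subtraction of natural numbers is not truncated because the coefficients
    increase along the subsequence.\<close>
  let ?u = "\<Sum>g\<in>G. real (P g (Suc n) - P g n) *\<^sub>R g"
  have "?u = (\<Sum>g\<in>G. real (P g (Suc n)) *\<^sub>R g) - (\<Sum>g\<in>G. real (P g n) *\<^sub>R g)"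
    unfolding sum_subtractf[symmetric]
    using monoD[OF P_mono] by (intro sum.cong) (auto simp: of_nat_diff scaleR_left_diff_distrib)
  then have \<pi>u: "\<pi> ?u = w (Suc n) - w n" by (simp add: linear_diff[OF lin] wP)
  have "- ?u \<in> A" using n(2) by (intro good_sum_reversible) auto
  then have "?u \<in> L" using e(2)[OF nat_spanI] n(1) \<pi>u by simp
  then show False using \<pi>u \<pi>_L w_inj by simp
qed

text \<open>An approximation \<open>u\<close> of a multiple \<open>q w\<close> of a point
  \<open>w \<in> L\<close> is invertible in \<open>A\<close> and has a small projection, so
  discreteness puts it into \<open>L\<close> exactly.\<close>

lemma lattice_direction:
  assumes discrete_mod and c: "\<And>g. g \<in> G \<Longrightarrow> 0 \<le> c g" "(\<Sum>g\<in>G. c g *\<^sub>R g) \<in> L" and "0 < e"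
  obtains q :: nat and p :: "'a \<Rightarrow> nat" where "0 < q" "(\<Sum>g\<in>G. real (p g) *\<^sub>R g) \<in> L"
    "\<And>g. g \<in> G \<Longrightarrow> c g = 0 \<Longrightarrow> p g = 0"
    "dist ((1 / real q) *\<^sub>R (\<Sum>g\<in>G. real (p g) *\<^sub>R g)) (\<Sum>g\<in>G. c g *\<^sub>R g) < e"
proof -
  obtain e0 where e0: "0 < e0" "\<And>u. u \<in> M \<Longrightarrow> - u \<in> A \<Longrightarrow> norm (\<pi> u) < e0 \<Longrightarrow> u \<in> L"
    using assms(1) unfolding discrete_mod_def by blast
  define C where "C = (\<Sum>g\<in>G. norm (\<pi> g)) + (\<Sum>g\<in>G. norm g) + 1"
  have C: "0 < C" "(\<Sum>g\<in>G. norm (\<pi> g)) < C" "(\<Sum>g\<in>G. norm g) < C"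
    using sum_nonneg[of G norm] sum_nonneg[of G "\<lambda>g. norm (\<pi> g)"] by (auto simp: C_def)
  \<comment> \<open>The bound 1 forces \<open>p g = 0\<close> where \<open>c g = 0\<close>;
    \<open>e0\<close> controls the projection of \<open>u\<close> and \<open>e\<close> its distance
    from \<open>q w\<close>.\<close>
  define \<delta> where "\<delta> = min 1 (min e0 e / C)"
  have "0 < \<delta>" using e0(1) \<open>0 < e\<close> C(1) by (simp add: \<delta>_def)
  have "\<delta> \<le> min e0 e / C" by (simp add: \<delta>_def)
  then have "\<delta> * C \<le> min e0 e" using C(1) by (simp add: field_simps)
  then have \<delta>C: "\<delta> * x < e0" "\<delta> * x < e" if "x < C" for x
    using mult_strict_left_mono[OF that \<open>0 < \<delta>\<close>] by auto
  obtain q p where q: "0 < (q::nat)" "\<And>g. g \<in> G \<Longrightarrow> \<bar>real (p g) - real q * c g\<bar> < \<delta>"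
    by (rule simultaneous_approximation[OF finG _ \<open>0 < \<delta>\<close>, where c = c and N = 0]) (use c(1) in auto)
  define u where "u = (\<Sum>g\<in>G. real (p g) *\<^sub>R g)"
  define x where "x = (\<Sum>g\<in>G. c g *\<^sub>R g)"
  have p0: "p g = 0" if "g \<in> G" "c g = 0" for g
    using q(2)[OF that(1)] that(2) by (simp add: \<delta>_def)
  have "- u \<in> A" unfolding u_def using c p0 by (intro reversible[of c]) auto
  have ux: "u - real q *\<^sub>R x = (\<Sum>g\<in>G. (real (p g) - real q * c g) *\<^sub>R g)"
    by (simp add: u_def x_def scaleR_left_diff_distrib sum_subtractf scaleR_sum_right)
  have "\<pi> u = \<pi> (u - real q *\<^sub>R x)"
    using c(2) by (simp add: linear_diff[OF lin] linear_cmul[OF lin] \<pi>_L x_def)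
  also have "\<dots> = (\<Sum>g\<in>G. (real (p g) - real q * c g) *\<^sub>R \<pi> g)" by (simp only: ux \<pi>_sum)
  finally have "norm (\<pi> u) \<le> \<delta> * (\<Sum>g\<in>G. norm (\<pi> g))"
    using norm_weighted_sum_le[OF finG, of _ \<delta> \<pi>] q(2) by (simp add: less_imp_le)
  then have "u \<in> L" using e0(2)[of u] \<open>- u \<in> A\<close> \<delta>C(1)[OF C(2)] by (simp add: u_def nat_spanI)
  have "norm (u - real q *\<^sub>R x) \<le> \<delta> * (\<Sum>g\<in>G. norm g)"
    unfolding ux using norm_weighted_sum_le[OF finG, of _ \<delta> "\<lambda>g. g"] q(2) by (simp add: less_imp_le)
  then have n: "norm (u - real q *\<^sub>R x) < e" using \<delta>C(2)[OF C(3)] by simp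
  have "(1 / real q) *\<^sub>R u - x = (1 / real q) *\<^sub>R (u - real q *\<^sub>R x)"
    using q(1) by (simp add: scaleR_diff_right)
  then have "dist ((1 / real q) *\<^sub>R u) x = norm (u - real q *\<^sub>R x) / real q"
    by (simp add: dist_norm)
  also have "\<dots> \<le> norm (u - real q *\<^sub>R x)" using q(1) mult_left_mono[of 1 "real q" "norm (u - real q *\<^sub>R x)"] by (simp add: divide_le_eq)
  finally have "dist ((1 / real q) *\<^sub>R u) x < e" using n by simp
  then show ?thesis
    using that[of q p] q(1) \<open>u \<in> L\<close> p0 by (simp add: u_def x_def)
qed

end

section \<open>Rational points and the rationality of \<open>L \<inter> K\<close>\<close>

lemma rational_points_add: "x \<in> rational_points \<Longrightarrow> y \<in> rational_points \<Longrightarrow> x + y \<in> rational_points"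
  by (auto simp: rational_points_def)

lemma rational_points_diff: "x \<in> rational_points \<Longrightarrow> y \<in> rational_points \<Longrightarrow> x - y \<in> rational_points"
  by (auto simp: rational_points_def)

lemma rational_points_scale: "c \<in> \<rat> \<Longrightarrow> x \<in> rational_points \<Longrightarrow> c *\<^sub>R x \<in> rational_points"
  by (auto simp: rational_points_def)

lemma rational_points_0: "0 \<in> rational_points"
  by (auto simp: rational_points_def)

lemma rational_points_sum:
  assumes "\<And>g. g \<in> G \<Longrightarrow> f g \<in> rational_points"
  shows "(\<Sum>g\<in>G. f g) \<in> rational_points"
  using assms by (induction G rule: infinite_finite_induct) (auto simp: rational_points_0 rational_points_add)

lemma rational_points_inner: "x \<in> rational_points \<Longrightarrow> y \<in> rational_points \<Longrightarrow> x \<bullet> y \<in> \<rat>"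
proof -
  assume "x \<in> rational_points" "y \<in> rational_points"
  then have "x $ i * y $ i \<in> \<rat>" for i by (simp add: rational_points_def Rats_mult)
  then have "(\<Sum>i\<in>J. x $ i * y $ i) \<in> \<rat>" for J
    by (induction J rule: infinite_finite_induct) (auto intro: Rats_add)
  then show ?thesis by (simp add: inner_vec_def)
qed

lemma integral_subset_rational: "integral_points \<subseteq> rational_points"
  by (auto simp: integral_points_def rational_points_def Ints_subset_Rats[THEN subsetD])

text \<open>\<open>lattice_direction\<close> only places \<open>w\<close> in the closure of the cone
  generated by rational points. Restricted to the generators in the support of \<open>w\<close>,
  that closure is a cone \<open>C\<close> with \<open>w\<close> in its relative interior, and the
  relative interior already belongs to the cone before closure.\<close>

lemma rational_cone_of_discrete_mod:
  fixes G :: "(real^'n) set"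
  assumes "monoid_mod_subspace G L \<pi>" and GQ: "G \<subseteq> rational_points"
    and disc: "monoid_mod_subspace.discrete_mod G L \<pi>"
  shows "rational_cone (L \<inter> convex_cone hull G)"
proof -
  interpret monoid_mod_subspace G L \<pi> by fact
  let ?V = "L \<inter> K \<inter> rational_points"
  have cc: "convex_cone (L \<inter> convex_cone hull G')" for G'
    using convex_cone_convex_cone_hull[of G'] subspace_imp_convex_cone[OF subL]
    by (auto simp: convex_cone_iff)
  have "L \<inter> K \<subseteq> convex_cone hull ?V"
  proof
    fix w assume "w \<in> L \<inter> K"
    then obtain c where w: "w = (\<Sum>g\<in>G. c g *\<^sub>R g)" "\<And>g. g \<in> G \<Longrightarrow> 0 \<le> c g" "w \<in> L"
      by (auto simp: convex_cone_hull_finite[OF finG])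
    \<comment> \<open>All coefficients of \<open>w\<close> over \<open>G'\<close> are positive,
      which is what makes \<open>w\<close> a relative interior point of \<open>C\<close>.\<close>
    define G' where "G' = {g \<in> G. c g \<noteq> 0}"
    have G': "finite G'" "G' \<subseteq> G" "\<And>g. g \<in> G' \<Longrightarrow> 0 < c g"
      using finG w(2) by (auto simp: G'_def less_le)
    define C where "C = L \<inter> convex_cone hull G'"
    have C_iff: "x \<in> C \<longleftrightarrow> x \<in> L \<and> (\<exists>d. x = (\<Sum>g\<in>G'. d g *\<^sub>R g) \<and> (\<forall>g\<in>G'. 0 \<le> d g))" for x
      by (auto simp: C_def convex_cone_hull_finite[OF G'(1)])
    have w': "w = (\<Sum>g\<in>G'. c g *\<^sub>R g)"
      unfolding w(1) by (rule sum.mono_neutral_right[OF finG]) (auto simp: G'_def)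
    then have wC: "w \<in> C" using w(3) G'(3) by (auto simp: C_iff less_imp_le)
    have convC: "convex C" using cc[of G'] by (simp add: C_def convex_cone_def)
    have "closed C"
      unfolding C_def using closed_subspace[OF subL] closed_convex_cone_hull[OF G'(1)] by (rule closed_Int)
    let ?H = "convex_cone hull (C \<inter> rational_points)"
    have "?H \<subseteq> C" using cc[of G'] by (intro hull_minimal) (auto simp: C_def)
    moreover have "C \<subseteq> closure ?H"
    proof
      fix x assume "x \<in> C"
      then obtain d where d: "x = (\<Sum>g\<in>G'. d g *\<^sub>R g)" "\<forall>g\<in>G'. 0 \<le> d g" "x \<in> L"
        by (auto simp: C_iff)
      \<comment> \<open>Extension by 0: the approximants vanish where \<open>d'\<close> does and
        therefore stay in the cone of \<open>G'\<close>.\<close>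
      define d' where "d' g = (if g \<in> G' then d g else 0)" for g
      have x: "x = (\<Sum>g\<in>G. d' g *\<^sub>R g)"
        unfolding d(1) by (rule sum.mono_neutral_cong_left[OF finG G'(2)]) (auto simp: d'_def)
      show "x \<in> closure ?H"
        unfolding closure_approachable
      proof (intro allI impI)
        fix e :: real assume "0 < e"
        obtain q p where q: "0 < (q::nat)" "(\<Sum>g\<in>G. real (p g) *\<^sub>R g) \<in> L"
          "\<And>g. g \<in> G \<Longrightarrow> d' g = 0 \<Longrightarrow> p g = 0"
          "dist ((1 / real q) *\<^sub>R (\<Sum>g\<in>G. real (p g) *\<^sub>R g)) x < e"
          unfolding x
          by (rule lattice_direction[OF disc _ _ \<open>0 < e\<close>, of d']) (use d x in \<open>auto simp: d'_def\<close>)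
        let ?y = "(1 / real q) *\<^sub>R (\<Sum>g\<in>G. real (p g) *\<^sub>R g)"
        have "(\<Sum>g\<in>G. real (p g) *\<^sub>R g) = (\<Sum>g\<in>G'. real (p g) *\<^sub>R g)"
          using q(3) G'(2) by (intro sum.mono_neutral_right[OF finG]) (auto simp: d'_def)
        then have "?y = (\<Sum>g\<in>G'. (real (p g) / real q) *\<^sub>R g)"
          by (simp add: scaleR_sum_right)
        then have "?y \<in> C"
          using subspace_scale[OF subL q(2), of "1 / real q"] unfolding C_iff by (auto intro!: exI[of _ "\<lambda>g. real (p g) / real q"])
        moreover have "?y \<in> rational_points"
          using GQ by (intro rational_points_scale rational_points_sum) auto
        ultimately show "\<exists>y\<in>?H. dist y x < e" using q(4) by (meson IntI hull_inc)
      qed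
    qed
    ultimately have "closure ?H = C"
      using \<open>closed C\<close> by (simp add: closure_minimal subset_antisym)
    then have "rel_interior ?H = rel_interior C"
      using convex_rel_interior_closure[OF convex_convex_cone_hull, of "C \<inter> rational_points"] by simp
    moreover have "w \<in> rel_interior C"
    proof -
      have "\<exists>e>1. (1 - e) *\<^sub>R x + e *\<^sub>R w \<in> C" if x: "x \<in> C" for x
      proof -
        obtain d where d: "x = (\<Sum>g\<in>G'. d g *\<^sub>R g)" "\<forall>g\<in>G'. 0 \<le> d g" "x \<in> L"
          using x by (auto simp: C_iff)
        \<comment> \<open>\<open>s\<close> exceeds all ratios \<open>d g / c g\<close>, so a step of
          relative size \<open>1 / s\<close> beyond \<open>w\<close>, away from \<open>x\<close>,
          keeps the coefficients nonnegative; the summand 1 keeps \<open>s\<close> positive.\<close>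
        define s where "s = (\<Sum>g\<in>G'. d g / c g) + 1"
        have s: "d g / c g \<le> s" if "g \<in> G'" for g
          using member_le_sum[of g G' "\<lambda>g. d g / c g"] that d(2) G' by (force simp: s_def less_imp_le)
        have "0 < s" using d(2) G'(3) by (auto simp: s_def less_imp_le intro!: add_nonneg_pos sum_nonneg divide_nonneg_pos)
        define e where "e = 1 / s"
        have "0 < e" using \<open>0 < s\<close> by (simp add: e_def)
        have "0 \<le> (1 + e) * c g - e * d g" if "g \<in> G'" for g
        proof -
          have "d g \<le> s * c g" using s[OF that] G'(3)[OF that] by (simp add: field_simps)
          then have "e * d g \<le> c g" using \<open>0 < s\<close> by (simp add: e_def field_simps)
          moreover have "0 \<le> e * c g" using \<open>0 < e\<close> G'(3)[OF that] by simp
          ultimately show ?thesis by (simp add: algebra_simps)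
        qed
        moreover have "(1 - (1 + e)) *\<^sub>R x + (1 + e) *\<^sub>R w = (\<Sum>g\<in>G'. ((1 + e) * c g - e * d g) *\<^sub>R g)"
          unfolding d(1) w' by (simp add: scaleR_sum_right scaleR_left_diff_distrib sum_subtractf sum_negf)
        moreover have "(1 - (1 + e)) *\<^sub>R x + (1 + e) *\<^sub>R w \<in> L"
          using d(3) w(3) by (intro subspace_add subspace_scale subL)
        ultimately have "(1 - (1 + e)) *\<^sub>R x + (1 + e) *\<^sub>R w \<in> C" 
          unfolding C_iff by (intro conjI exI[of _ "\<lambda>g. (1 + e) * c g - e * d g"]) auto
        then show ?thesis using \<open>0 < e\<close> by (intro exI[of _ "1 + e"]) simp
      qed
      then show ?thesis using convex_rel_interior_iff[OF convC] wC by blast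
    qed
    ultimately have "w \<in> ?H" using rel_interior_subset by blast
    moreover have "convex_cone hull G' \<subseteq> K" using G'(2) by (rule hull_mono)
    then have "?H \<subseteq> convex_cone hull ?V" by (intro hull_mono) (auto simp: C_def)
    ultimately show "w \<in> convex_cone hull ?V" by blast
  qed
  moreover have "convex_cone hull ?V \<subseteq> L \<inter> K" using cc[of G] by (intro hull_minimal) auto
  ultimately show ?thesis unfolding rational_cone_def by (intro exI[of _ ?V]) auto
qed

section \<open>Rational subspaces, recession cones and lineality spaces\<close>

text \<open>Gram--Schmidt orthogonalisation does not leave the rational points.\<close>

lemma rational_orthogonal_projection:
  fixes g :: "real^'n"
  assumes "finite V" "V \<subseteq> rational_points" "g \<in> rational_points"
  shows "\<exists>p \<in> span V \<inter> rational_points. \<forall>v\<in>V. (g - p) \<bullet> v = 0"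
  using assms
proof (induction V arbitrary: g)
  case empty
  then show ?case by (intro bexI[of _ 0]) (auto simp: rational_points_0)
next
  case (insert v V)
  have span_orth: "z \<bullet> y = 0" if "\<And>v. v \<in> V \<Longrightarrow> z \<bullet> v = 0" "y \<in> span V" for z y :: "real^'n"
    using orthogonal_to_span[of y V z] that by (simp add: orthogonal_def)
  obtain pv where pv: "pv \<in> span V" "pv \<in> rational_points" "\<And>x. x \<in> V \<Longrightarrow> (v - pv) \<bullet> x = 0"
    using insert.IH[of v] insert.prems by blast
  obtain pg where pg: "pg \<in> span V" "pg \<in> rational_points" "\<And>x. x \<in> V \<Longrightarrow> (g - pg) \<bullet> x = 0"
    using insert.IH[of g] insert.prems by blast
  define z where "z = v - pv"
  have spanI: "x \<in> span (insert v V)" if "x \<in> span V" for x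
    using that span_mono[of V "insert v V"] by blast
  show ?case
  proof (cases "z = 0")
    case True
    then have "(g - pg) \<bullet> v = 0" using span_orth[OF pg(3)] pv(1) by (simp add: z_def)
    then show ?thesis using pg spanI by (intro bexI[of _ pg]) auto
  next
    case False
    \<comment> \<open>\<open>z\<close> is the part of \<open>v\<close> orthogonal to
      \<open>V\<close>, and \<open>p\<close> adds to the projection on \<open>span V\<close> the
      component of \<open>g\<close> along \<open>z\<close>.\<close>
    define p where "p = pg + ((g \<bullet> z) / (z \<bullet> z)) *\<^sub>R z"
    have zQ: "z \<in> rational_points" using pv insert.prems by (simp add: z_def rational_points_diff)
    have zorth: "z \<bullet> y = 0" if "y \<in> span V" for y
      using span_orth[of z y] pv(3) that by (simp add: z_def)
    have "p \<in> rational_points"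
      unfolding p_def using pg(2) zQ insert.prems
      by (intro rational_points_add rational_points_scale Rats_divide rational_points_inner) auto
    moreover have "z \<in> span (insert v V)"
      unfolding z_def by (intro span_diff[OF span_base[OF insertI1] spanI[OF pv(1)]])
    then have "p \<in> span (insert v V)"
      unfolding p_def by (intro span_add[OF spanI[OF pg(1)]] span_scale)
    moreover have gpV: "(g - p) \<bullet> y = 0" if "y \<in> span V" for y
      using span_orth[OF pg(3) that] zorth[OF that]
      by (simp add: p_def inner_diff_left inner_add_left)
    moreover have "(g - p) \<bullet> v = 0"
    proof -
      have "pg \<bullet> z = 0" using zorth[OF pg(1)] by (simp add: inner_commute)
      then have "(g - p) \<bullet> z = 0" using False by (simp add: p_def inner_diff_left inner_add_left)
      then have "(g - p) \<bullet> z + (g - p) \<bullet> pv = 0" using gpV[OF pv(1)] by simp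
      then show ?thesis by (simp add: z_def flip: inner_add_right)
    qed
    ultimately show ?thesis using span_base by (intro bexI[of _ p]) auto
  qed
qed

text \<open>Pairing \<open>g - t h\<close> with the component \<open>z\<close> of \<open>h\<close>
  orthogonal to \<open>V\<close>, a rational vector, gives \<open>t\<close> as the quotient of the
  rational numbers \<open>z \<bullet> g\<close> and \<open>z \<bullet> h\<close>.\<close>

lemma rational_coefficient:
  fixes g h :: "real^'n"
  assumes "V \<subseteq> rational_points" "g \<in> rational_points" "h \<in> rational_points"
    and "h \<notin> span V" "g - t *\<^sub>R h \<in> span V"
  shows "t \<in> \<rat>"
proof -
  obtain B where B: "B \<subseteq> V" "independent B" "V \<subseteq> span B"
    using maximal_independent_subset[of V] by blast
  have spB: "span B = span V"
    using B by (metis span_mono span_span subset_antisym)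
  have "finite B" using B(2) by (rule independent_imp_finite)
  then obtain p where p: "p \<in> span B" "p \<in> rational_points" "\<forall>v\<in>B. (h - p) \<bullet> v = 0"
    using rational_orthogonal_projection[of B h] B(1) assms(1,3) by blast
  define z where "z = h - p"
  have z: "z \<bullet> y = 0" if "y \<in> span V" for y
    using orthogonal_to_span[of y B z] that spB p(3) by (simp add: orthogonal_def z_def)
  have "z \<noteq> 0" using p(1) assms(4) spB by (auto simp: z_def)
  moreover have "z \<bullet> h = z \<bullet> z" using z[of p] p(1) spB by (simp add: z_def inner_diff_right)
  ultimately have "z \<bullet> h \<noteq> 0" by simp
  moreover have "z \<bullet> g = t * (z \<bullet> h)" using z[OF assms(5)] by (simp add: inner_diff_right)
  ultimately have "t = (z \<bullet> g) / (z \<bullet> h)" by simp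
  moreover have "z \<in> rational_points" using p assms(3) by (simp add: z_def rational_points_diff)
  ultimately show ?thesis using assms by (simp add: Rats_divide rational_points_inner)
qed

text \<open>The orthogonal projection onto the line spanned by \<open>a\<close>, for nonzero
  \<open>a\<close>.\<close>

definition normal_part :: "'a::real_inner \<Rightarrow> 'a \<Rightarrow> 'a" where
  "normal_part a x = ((a \<bullet> x) / (a \<bullet> a)) *\<^sub>R a"

lemma norm_normal_part: "a \<noteq> 0 \<Longrightarrow> norm (normal_part a x) = \<bar>a \<bullet> x\<bar> / norm a"
  by (simp add: normal_part_def dot_square_norm power2_eq_square)

lemma monoid_mod_hyperplane:
  fixes G :: "'a::euclidean_space set"
  assumes "finite G" "a \<noteq> 0"
  shows "monoid_mod_subspace G {x. a \<bullet> x = 0} (normal_part a)"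
proof (rule monoid_mod_subspace.intro)
  show "linear (normal_part a)"
    by (rule linearI) (auto simp: normal_part_def inner_add_right add_divide_distrib scaleR_left_distrib)
qed (use assms in \<open>auto simp: normal_part_def subspace_hyperplane inner_diff_right\<close>)

text \<open>For good \<open>g\<close> and \<open>h\<close> the vector \<open>g - t h\<close> in the
  hyperplane is a multiple of a difference of two points of \<open>L \<inter> K\<close>, so it lies
  in the span of rational generators and \<open>t\<close> is rational. Hence \<open>a\<close> takes
  on good generators integer multiples of one number \<open>\<beta>\<close>, and an invertible
  \<open>u\<close>, being supported on good generators, has \<open>a \<bullet> u = 0\<close> as soon
  as this value is below \<open>\<beta>\<close> in absolute value.\<close>

lemma discrete_mod_of_rational_cone:
  fixes a :: "real^'n"
  assumes "finite G" "G \<subseteq> rational_points" "a \<noteq> 0"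
    and rat: "rational_cone ({x. a \<bullet> x = 0} \<inter> convex_cone hull G)"
  shows "monoid_mod_subspace.discrete_mod G {x. a \<bullet> x = 0} (normal_part a)"
proof -
  interpret monoid_mod_subspace G "{x. a \<bullet> x = 0}" "normal_part a"
    using assms by (intro monoid_mod_hyperplane)
  obtain V where V: "V \<subseteq> rational_points" "{x. a \<bullet> x = 0} \<inter> K = convex_cone hull V"
    using rat unfolding rational_cone_def by blast
  have V0: "a \<bullet> v = 0" if "v \<in> span V" for v
  proof -
    have "V \<subseteq> {x. a \<bullet> x = 0}" using V(2) hull_subset[of V convex_cone] by blast
    then show ?thesis using span_minimal[OF _ subL] that by blast
  qed
  have W_span: "w \<in> span V" if "a \<bullet> w = 0" "w \<in> K" for w
  proof -
    have "convex_cone hull V \<subseteq> span V"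
      by (intro hull_minimal span_superset convex_cone_span)
    then show ?thesis using that V(2) by blast
  qed
  have kernel: "\<exists>k\<in>K. a \<bullet> (g + k) = 0" if g: "g \<in> good" for g
  proof -
    obtain k where k: "k \<in> K" "- normal_part a g = normal_part a k" using g by (auto simp: good_def)
    have "normal_part a (g + k) = 0" using k(2) by (simp add: linear_add[OF lin] flip: k(2))
    then show ?thesis using \<pi>_eq_0 k(1) by auto
  qed
  have rat_ratio: "(a \<bullet> g) / (a \<bullet> h) \<in> \<rat>" if gh: "g \<in> good" "h \<in> good" "a \<bullet> h \<noteq> 0" for g h
  proof -
    obtain k where k: "k \<in> K" "a \<bullet> (g + k) = 0" using kernel gh by blast
    obtain l where l: "l \<in> K" "a \<bullet> (h + l) = 0" using kernel gh by blast
    have G: "g \<in> G" "h \<in> G" using gh by (auto simp: good_def)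
    then have gK: "g \<in> K" "h \<in> K" by (auto simp: hull_inc)
    define t where "t = (a \<bullet> g) / (a \<bullet> h)"
    \<comment> \<open>Small enough that \<open>1 - e * t\<close> is nonnegative: the coefficient 1
      of \<open>h\<close> in \<open>w\<close> pays for subtracting \<open>e * t\<close> copies of
      \<open>h\<close>.\<close>
    define e where "e = 1 / (\<bar>t\<bar> + 1)"
    have e: "0 < e" "e * \<bar>t\<bar> \<le> 1" by (auto simp: e_def field_simps)
    define w where "w = (g + k) + (h + l)"
    define x where "x = g - t *\<^sub>R h"
    have ax: "a \<bullet> x = 0" using gh(3) by (simp add: x_def t_def inner_diff_right)
    have aw: "a \<bullet> w = 0" using k(2) l(2) by (simp add: w_def inner_add_right)
    have "w \<in> K" unfolding w_def using gK k l by (intro convex_cone_hull_add)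
    have "e * t \<le> 1" using e by (smt (verit) abs_ge_self mult_left_mono)
    have "w + e *\<^sub>R x = (1 + e) *\<^sub>R g + k + (1 - e * t) *\<^sub>R h + l"
      by (simp add: w_def x_def algebra_simps)
    also have "\<dots> \<in> K"
      using gK k l e(1) \<open>e * t \<le> 1\<close> by (intro convex_cone_hull_add convex_cone_hull_mul) auto
    finally have "w + e *\<^sub>R x \<in> span V" using W_span ax aw by (simp add: inner_add_right)
    then have "(w + e *\<^sub>R x) - w \<in> span V"
      using W_span[OF aw \<open>w \<in> K\<close>] by (intro span_diff)
    then have "(1 / e) *\<^sub>R ((w + e *\<^sub>R x) - w) \<in> span V" by (rule span_scale)
    then have "g - t *\<^sub>R h \<in> span V" using e(1) by (simp add: x_def)
    moreover have "h \<notin> span V" using V0 gh(3) by blast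
    ultimately show ?thesis
      using rational_coefficient[of V g h t] V(1) G assms(2) by (auto simp: t_def)
  qed
  \<comment> \<open>All ratios to one nonzero value \<open>a \<bullet> h\<close> have a common
    denominator \<open>N\<close>, which gives the unit \<open>\<bar>a \<bullet> h\<bar> / N\<close>;
    if all values vanish, the unit 1 is chosen.\<close>
  have "\<exists>\<beta>>0. \<forall>g\<in>good. (a \<bullet> g) / \<beta> \<in> \<int>"
  proof (cases "\<exists>h\<in>good. a \<bullet> h \<noteq> 0")
    case True
    then obtain h where h: "h \<in> good" "a \<bullet> h \<noteq> 0" by blast
    have "finite good" using finG by (simp add: good_def)
    then obtain N :: nat where N: "0 < N" "\<And>g. g \<in> good \<Longrightarrow> real N * ((a \<bullet> g) / (a \<bullet> h)) \<in> \<int>"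
      using common_denominator[of good "\<lambda>g. (a \<bullet> g) / (a \<bullet> h)"] rat_ratio h by metis
    have "(a \<bullet> g) / (\<bar>a \<bullet> h\<bar> / real N) \<in> \<int>" if "g \<in> good" for g
      using N(2)[OF that] Ints_minus[OF N(2)[OF that]]
      by (cases "a \<bullet> h > 0") (auto simp: mult.commute abs_if)
    then show ?thesis using h N(1) by (intro exI[of _ "\<bar>a \<bullet> h\<bar> / real N"]) auto
  qed (auto intro: exI[of _ 1])
  then obtain \<beta> where \<beta>: "0 < \<beta>" "\<And>g. g \<in> good \<Longrightarrow> (a \<bullet> g) / \<beta> \<in> \<int>" by blast
  show ?thesis
    unfolding discrete_mod_def
  proof (intro exI[of _ "\<beta> / norm a"] conjI ballI impI)
    show "0 < \<beta> / norm a" using \<beta>(1) assms(3) by simp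
    fix u assume u: "u \<in> M" "- u \<in> A" "norm (normal_part a u) < \<beta> / norm a"
    obtain p where p: "u = (\<Sum>g\<in>G. real (p g) *\<^sub>R g)" using u(1) by (auto simp: nat_span_def)
    have "(a \<bullet> u) / \<beta> = (\<Sum>g\<in>G. real (p g) * ((a \<bullet> g) / \<beta>))"
      by (simp add: p inner_sum_right sum_divide_distrib)
    also have "\<dots> \<in> \<int>"
    proof (rule Ints_sum)
      fix g assume "g \<in> G"
      show "real (p g) * ((a \<bullet> g) / \<beta>) \<in> \<int>"
      proof (cases "p g = 0")
        case False
        then have "g \<in> good" using reversible_support_good[of p g] u(2) \<open>g \<in> G\<close> by (simp add: p)
        then show ?thesis using Ints_mult[OF Ints_of_nat \<beta>(2)] by blast
      qed simp
    qed
    finally have int: "(a \<bullet> u) / \<beta> \<in> \<int>" .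
    have "\<bar>a \<bullet> u\<bar> < \<beta>" using u(3) assms(3) by (simp add: norm_normal_part divide_less_cancel)
    then have "\<bar>(a \<bullet> u) / \<beta>\<bar> < 1" using \<beta>(1) by simp
    then have "(a \<bullet> u) / \<beta> = 0" using int Ints_nonzero_abs_less1 by blast
    then show "u \<in> {x. a \<bullet> x = 0}" using \<beta>(1) by simp
  qed
qed

section \<open>Recession cones and lineality spaces of convex sets\<close>

lemma recession_cone_closedI:
  assumes "closed C" "convex C" "x0 \<in> C" "\<And>l. 0 \<le> l \<Longrightarrow> x0 + l *\<^sub>R r \<in> C"
  shows "r \<in> recession_cone C"
  unfolding recession_cone_def
proof (intro CollectI ballI allI impI)
  fix x and l :: real assume x: "x \<in> C" and l: "0 \<le> l"
  \<comment> \<open>Weight \<open>u n\<close> on the point of the ray from \<open>x0\<close> at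
    parameter \<open>l / u n\<close>: the convex combinations with \<open>x\<close> lie in
    \<open>C\<close> and tend to \<open>x + l r\<close>, so one ray determines the recession
    direction.\<close>
  define u where "u n = inverse (real (Suc n))" for n
  have lim: "(\<lambda>n. (1 - u n) *\<^sub>R x + u n *\<^sub>R x0 + l *\<^sub>R r) \<longlonglongrightarrow> (1 - 0) *\<^sub>R x + 0 *\<^sub>R x0 + l *\<^sub>R r"
    unfolding u_def by (intro tendsto_intros LIMSEQ_inverse_real_of_nat)
  have mem: "(1 - u n) *\<^sub>R x + u n *\<^sub>R x0 + l *\<^sub>R r \<in> C" for n
  proof -
    have "(1 - u n) *\<^sub>R x + u n *\<^sub>R (x0 + (real (Suc n) * l) *\<^sub>R r) \<in> C"
      using assms(2) x assms(4)[of "real (Suc n) * l"] l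
      by (intro convexD) (auto simp: u_def field_simps)
    moreover have "u n *\<^sub>R (real (Suc n) * l) *\<^sub>R r = l *\<^sub>R r"
      by (simp add: u_def del: of_nat_Suc)
    ultimately show ?thesis by (simp only: scaleR_right_distrib add.assoc)
  qed
  from closed_sequentially[OF assms(1) mem lim]
  show "x + l *\<^sub>R r \<in> C" by simp
qed

text \<open>A recession direction of the intersection gives a ray from a common point; it lies in
  both sets, and in a closed convex set one ray suffices.\<close>

lemma recession_cone_Int:
  assumes "closed B" "convex B" "closed C" "convex C" "B \<inter> C \<noteq> {}"
  shows "recession_cone (B \<inter> C) = recession_cone B \<inter> recession_cone C"
proof
  obtain x0 where x0: "x0 \<in> B" "x0 \<in> C" using assms(5) by blast
  show "recession_cone (B \<inter> C) \<subseteq> recession_cone B \<inter> recession_cone C"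
  proof
    fix r assume "r \<in> recession_cone (B \<inter> C)"
    then have "x0 + l *\<^sub>R r \<in> B \<inter> C" if "0 \<le> l" for l
      using x0 that by (auto simp: recession_cone_def)
    then show "r \<in> recession_cone B \<inter> recession_cone C"
      using recession_cone_closedI[OF assms(1,2) x0(1), of r] recession_cone_closedI[OF assms(3,4) x0(2), of r]
      by blast
  qed
qed (auto simp: recession_cone_def)

lemma recession_cone_add:
  assumes "r \<in> recession_cone B" "s \<in> recession_cone B"
  shows "r + s \<in> recession_cone B"
proof -
  have "(x + l *\<^sub>R r) + l *\<^sub>R s \<in> B" if "x \<in> B" "0 \<le> l" for x l
    using assms that by (auto simp: recession_cone_def)
  then show ?thesis by (auto simp: recession_cone_def scaleR_right_distrib add.assoc)
qed

lemma lineality_iff: "r \<in> lineality_space B \<longleftrightarrow> (\<forall>x\<in>B. \<forall>t. x + t *\<^sub>R r \<in> B)"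
proof
  assume r: "r \<in> lineality_space B"
  then have r: "r \<in> recession_cone B" "- r \<in> recession_cone B" by (auto simp: lineality_space_def)
  show "\<forall>x\<in>B. \<forall>t. x + t *\<^sub>R r \<in> B"
  proof (intro ballI allI)
    fix x t assume "x \<in> B"
    then show "x + t *\<^sub>R r \<in> B"
      using r(1)[unfolded recession_cone_def, simplified, rule_format, of x t]
        r(2)[unfolded recession_cone_def, simplified, rule_format, of x "- t"]
      by (cases "0 \<le> t") auto
  qed
next
  assume a: "\<forall>x\<in>B. \<forall>t. x + t *\<^sub>R r \<in> B"
  then have "r \<in> recession_cone B" by (simp add: recession_cone_def)
  moreover have "- r \<in> recession_cone B"
    unfolding recession_cone_def
  proof (intro CollectI ballI allI impI)
    fix x and l :: real assume "x \<in> B"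
    then have "x + (- l) *\<^sub>R r \<in> B" using a by blast
    then show "x + l *\<^sub>R (- r) \<in> B" by simp
  qed
  ultimately show "r \<in> lineality_space B"
    unfolding lineality_space_def by (metis IntI imageI minus_minus)
qed

lemma lineality_subset_recession: "lineality_space B \<subseteq> recession_cone B"
  by (simp add: lineality_space_def)

lemma subspace_lineality: "subspace (lineality_space B)"
  unfolding subspace_def
proof (intro conjI ballI allI)
  show "0 \<in> lineality_space B" by (simp add: lineality_iff)
next
  fix x y assume "x \<in> lineality_space B" "y \<in> lineality_space B"
  then have "(z + t *\<^sub>R x) + t *\<^sub>R y \<in> B" if "z \<in> B" for z t
    using that by (simp add: lineality_iff)
  then show "x + y \<in> lineality_space B"
    by (simp add: lineality_iff scaleR_right_distrib add.assoc)
next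
  fix c x assume "x \<in> lineality_space B"
  then have "z + (t * c) *\<^sub>R x \<in> B" if "z \<in> B" for z t
    using that by (simp add: lineality_iff)
  then show "c *\<^sub>R x \<in> lineality_space B" by (simp add: lineality_iff)
qed

lemma lineality_hyperplane: "lineality_space {x. a \<bullet> x = b} = {x. a \<bullet> x = 0}"
  if "a \<noteq> 0" for a :: "'a::euclidean_space"
proof
  have x0: "a \<bullet> ((b / (a \<bullet> a)) *\<^sub>R a) = b" using that by simp
  show "lineality_space {x. a \<bullet> x = b} \<subseteq> {x. a \<bullet> x = 0}"
  proof
    fix r assume "r \<in> lineality_space {x. a \<bullet> x = b}"
    then have "a \<bullet> ((b / (a \<bullet> a)) *\<^sub>R a + 1 *\<^sub>R r) = b"
      using x0 unfolding lineality_iff by blast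
    then show "r \<in> {x. a \<bullet> x = 0}" using x0 by (simp only: inner_add_right mem_Collect_eq scaleR_one)
  qed
qed (auto simp: lineality_iff inner_add_right)

lemma subspace_projection_exists:
  fixes L :: "'a::euclidean_space set"
  assumes "subspace L"
  obtains \<pi> :: "'a \<Rightarrow> 'a" where "linear \<pi>" "\<forall>x. x - \<pi> x \<in> L" "\<forall>x\<in>L. \<pi> x = 0"
proof -
  obtain B where B: "B \<subseteq> L" "pairwise orthogonal B" "\<And>x. x \<in> B \<Longrightarrow> norm x = 1"
    "independent B" "span B = L"
    using orthonormal_basis_subspace[OF assms] by metis
  have finB: "finite B" using B(4) by (rule independent_imp_finite)
  define \<pi> where "\<pi> x = x - (\<Sum>b\<in>B. (x \<bullet> b) *\<^sub>R b)" for x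
  have "linear \<pi>"
  proof (rule linearI)
    show "\<pi> (x + y) = \<pi> x + \<pi> y" for x y
      by (simp add: \<pi>_def inner_add_left scaleR_left_distrib sum.distrib)
    show "\<pi> (c *\<^sub>R x) = c *\<^sub>R \<pi> x" for c x
      by (simp add: \<pi>_def scaleR_right_diff_distrib scaleR_sum_right)
  qed
  moreover have "x - \<pi> x \<in> L" for x
    by (simp add: \<pi>_def B(5)[symmetric] span_sum span_scale span_base)
  moreover have "\<pi> x = 0" if "x \<in> L" for x
  proof -
    have "\<pi> b = 0" if "b \<in> B" for b
    proof -
      have "(\<Sum>c\<in>B. (b \<bullet> c) *\<^sub>R c) = (\<Sum>c\<in>B. if c = b then b else 0)"
        using B(2,3) that
        by (intro sum.cong) (auto simp: pairwise_def orthogonal_def inner_commute norm_eq_1)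
      then show ?thesis using finB that by (simp add: \<pi>_def)
    qed
    then show ?thesis
      using linear_eq_0_on_span[OF \<open>linear \<pi>\<close>, of B x] that B(5) by blast
  qed
  ultimately show ?thesis using that by blast
qed

section \<open>Points of a finitely generated set near an S-free convex set\<close>

text \<open>A point slightly beyond \<open>y\<close>, seen from an interior point \<open>z0\<close>
  of \<open>B\<close>, is still of the form \<open>b + t d\<close>. Contracting towards
  \<open>z0\<close> moves it back to \<open>y\<close> and moves \<open>b\<close> into the interior
  of \<open>B\<close>.\<close>

lemma interior_line_sum:
  fixes B :: "'a::euclidean_space set"
  assumes "convex B" "interior B \<noteq> {}" "y \<in> interior {x + t *\<^sub>R d |x t. x \<in> B}"
  obtains t where "y - t *\<^sub>R d \<in> interior B"
proof -
  obtain z0 where z0: "z0 \<in> interior B" using assms(2) by blast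
  let ?C = "{x + t *\<^sub>R d |x t. x \<in> B}"
  obtain e where e: "0 < e" "ball y e \<subseteq> ?C" using assms(3) mem_interior by blast
  \<comment> \<open>The overshoot stays within \<open>e / 2\<close>; the summand 1 avoids a division
    by 0 when \<open>y = z0\<close>.\<close>
  define s where "s = e / 2 / (norm (y - z0) + 1)"
  have N: "0 < norm (y - z0) + 1" by (simp add: add_nonneg_pos)
  then have "0 < s" using e(1) by (simp add: s_def)
  have "norm (s *\<^sub>R (y - z0)) \<le> e / 2"
  proof -
    have "s * norm (y - z0) \<le> s * (norm (y - z0) + 1)" using \<open>0 < s\<close> by simp
    also have "\<dots> = e / 2" using N unfolding s_def by (simp only: nonzero_divide_eq_eq times_divide_eq_left)
    finally show ?thesis using \<open>0 < s\<close> by simp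
  qed
  then have "y + s *\<^sub>R (y - z0) \<in> ball y e" using e(1) by (simp add: dist_norm)
  then obtain b t where b: "b \<in> B" "y + s *\<^sub>R (y - z0) = b + t *\<^sub>R d" using e(2) by blast
  define u where "u = 1 / (1 + s)"
  have u: "0 < u" "u < 1" "u * (1 + s) = 1" "1 - u = u * s"
    using \<open>0 < s\<close> by (auto simp: u_def field_simps)
  have "u *\<^sub>R (y + s *\<^sub>R (y - z0)) = u *\<^sub>R (b + t *\<^sub>R d)" using b(2) by simp
  then have "(u * (1 + s)) *\<^sub>R y - (u * s) *\<^sub>R z0 = u *\<^sub>R b + (u * t) *\<^sub>R d"
    by (simp add: algebra_simps)
  then have "y - (1 - u) *\<^sub>R z0 = u *\<^sub>R b + (u * t) *\<^sub>R d" by (simp only: u(3,4) scaleR_one)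
  then have "y - (u * t) *\<^sub>R d = u *\<^sub>R b + (1 - u) *\<^sub>R z0" by (simp only: diff_eq_eq ac_simps)
  also have "\<dots> = b - (1 - u) *\<^sub>R (b - z0)" by (simp add: algebra_simps)
  also have "\<dots> \<in> interior B"
    using mem_interior_convex_shrink[OF assms(1) z0 b(1), of "1 - u"] u by simp
  finally show ?thesis using that by blast
qed

lemma maximal_free_convex_eq:
  "maximal_free_convex S B \<Longrightarrow> free_convex S C \<Longrightarrow> B \<subseteq> C \<Longrightarrow> C = B"
  by (auto simp: maximal_free_convex_def)

lemma maximal_free_convex_closed:
  assumes "maximal_free_convex S B" shows "closed B"
proof -
  have "convex B" using assms by (simp add: maximal_free_convex_def free_convex_def)
  then have "free_convex S (closure B)"
    using assms by (simp add: maximal_free_convex_def free_convex_def convex_interior_closure convex_closure)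
  then have "closure B = B" using maximal_free_convex_eq[OF assms] closure_subset by blast
  then show ?thesis by (metis closed_closure)
qed

lemma convex_line_sum: "convex B \<Longrightarrow> convex {x + t *\<^sub>R d |x t. x \<in> B}"
proof -
  assume "convex B"
  then have "convex (\<Union>x\<in>B. \<Union>y\<in>span {d}. {x + y})"
    by (rule convex_sums) (simp add: subspace_imp_convex)
  also have "(\<Union>x\<in>B. \<Union>y\<in>span {d}. {x + y}) = {x + t *\<^sub>R d |x t. x \<in> B}"
    by (auto simp: span_singleton)
  finally show ?thesis .
qed

text \<open>The sum of \<open>B\<close> and the line through \<open>d\<close> is convex, and each of
  its interior points lies on a translate of the line through an interior point of \<open>B\<close>.
  So the sum is free, and maximality makes it equal to \<open>B\<close>.\<close>

lemma maximal_free_convex_line: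
  fixes B :: "'a::euclidean_space set"
  assumes max: "maximal_free_convex S B" and "interior B \<noteq> {}"
    and "\<And>y t. y \<in> S \<Longrightarrow> y + t *\<^sub>R d \<notin> interior B"
  shows "d \<in> lineality_space B"
proof -
  have convB: "convex B" using max by (simp add: maximal_free_convex_def free_convex_def)
  let ?C = "{x + t *\<^sub>R d |x t. x \<in> B}"
  have "y \<notin> S" if "y \<in> interior ?C" for y
  proof -
    obtain t where "y - t *\<^sub>R d \<in> interior B"
      by (rule interior_line_sum[OF convB assms(2) \<open>y \<in> interior ?C\<close>])
    then show ?thesis using assms(3)[of y "- t"] by auto
  qed
  then have "free_convex S ?C" using convex_line_sum[OF convB] by (auto simp: free_convex_def)
  moreover have "B \<subseteq> ?C"
  proof
    fix x assume "x \<in> B"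
    then show "x \<in> ?C" by (intro CollectI exI[of _ x] exI[of _ 0]) simp
  qed
  ultimately have "?C = B" by (rule maximal_free_convex_eq[OF max])
  then show ?thesis unfolding lineality_iff by blast
qed

lemma interior_lineality:
  assumes "x \<in> interior B" "l \<in> lineality_space B"
  shows "x + l \<in> interior B"
proof -
  obtain e where e: "0 < e" "ball x e \<subseteq> B" using assms(1) mem_interior by blast
  have "ball (x + l) e \<subseteq> B"
  proof
    fix y assume "y \<in> ball (x + l) e"
    then have "y - l \<in> B" using e(2) by (auto simp: dist_norm algebra_simps)
    then have "(y - l) + 1 *\<^sub>R l \<in> B" using assms(2) unfolding lineality_iff by blast
    then show "y \<in> B" by simp
  qed
  then show ?thesis using e(1) mem_interior by blast
qed

lemma valid_inequality_lineality:
  fixes B :: "'a::euclidean_space set"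
  assumes "B \<noteq> {}" "\<And>x. x \<in> B \<Longrightarrow> a \<bullet> x \<le> b" "l \<in> lineality_space B"
  shows "a \<bullet> l = 0"
proof (rule ccontr)
  assume n: "a \<bullet> l \<noteq> 0"
  obtain x where x: "x \<in> B" using assms(1) by blast
  \<comment> \<open>Chosen such that \<open>a \<bullet> (x + t l) = b + 1\<close>.\<close>
  define t where "t = (b - a \<bullet> x + 1) / (a \<bullet> l)"
  have "x + t *\<^sub>R l \<in> B" using assms(3) x unfolding lineality_iff by blast
  then have "a \<bullet> x + t * (a \<bullet> l) \<le> b" using assms(2)[of "x + t *\<^sub>R l"] by (simp add: inner_add_right)
  then show False using n by (simp add: t_def)
qed

lemma not_recession_separation:
  fixes B :: "'a::euclidean_space set"
  assumes "closed B" "convex B" "d \<notin> recession_cone B"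
  obtains a b where "\<And>x. x \<in> B \<Longrightarrow> a \<bullet> x \<le> b" "0 < a \<bullet> d"
proof -
  obtain x l where x: "x \<in> B" "0 \<le> l" "x + l *\<^sub>R d \<notin> B"
    using assms(3) by (auto simp: recession_cone_def)
  obtain a b where ab: "a \<bullet> (x + l *\<^sub>R d) < b" "\<forall>x\<in>B. b < a \<bullet> x"
    using separating_hyperplane_closed_point[OF assms(2,1) x(3)] by blast
  have "a \<bullet> x + l * (a \<bullet> d) < b" "b < a \<bullet> x" using ab x(1) by (auto simp: inner_add_right)
  then have "l * (a \<bullet> d) < 0" by linarith
  then have "0 < (- a) \<bullet> d" using x(2) by (simp add: mult_less_0_iff)
  moreover have "(- a) \<bullet> x \<le> - b" if "x \<in> B" for x using ab(2) that by (simp add: less_imp_le)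
  ultimately show ?thesis using that by blast
qed

section \<open>Points with distant projections\<close>

context monoid_mod_subspace
begin

text \<open>Otherwise there are points with projections tending to infinity that satisfy all
  inequalities up to 1. Their normalised projections accumulate at a unit vector of the closed
  projected cone, and dividing the inequalities by the norms shows that no \<open>a\<close> is
  positive there. The slack 1 leaves room for moving facets outwards.\<close>

lemma far_points_violate:
  assumes "finite F"
    and orth: "\<And>a b l. (a, b) \<in> D \<Longrightarrow> l \<in> L \<Longrightarrow> a \<bullet> l = 0"
    and pos: "\<And>d. d \<in> \<pi> ` K \<Longrightarrow> d \<noteq> 0 \<Longrightarrow> \<exists>(a, b)\<in>D. 0 < a \<bullet> d"
  shows "\<exists>R. \<forall>f\<in>F. \<forall>m\<in>M. R < norm (\<pi> m) \<longrightarrow> (\<exists>(a, b)\<in>D. b + 1 < a \<bullet> (f + m))"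
proof (rule ccontr)
  assume neg: "\<not> ?thesis"
  have "\<exists>f m. f \<in> F \<and> m \<in> M \<and> R < norm (\<pi> m) \<and> (\<forall>a b. (a, b) \<in> D \<longrightarrow> a \<bullet> (f + m) \<le> b + 1)" for R
  proof -
    have "\<not> (\<forall>f\<in>F. \<forall>m\<in>M. R < norm (\<pi> m) \<longrightarrow> (\<exists>(a, b)\<in>D. b + 1 < a \<bullet> (f + m)))"
      using neg by blast
    then obtain f m where fm: "f \<in> F" "m \<in> M" "R < norm (\<pi> m)" "\<not> (\<exists>(a, b)\<in>D. b + 1 < a \<bullet> (f + m))"
      by blast
    have "a \<bullet> (f + m) \<le> b + 1" if "(a, b) \<in> D" for a b
      using fm(4) that by (meson case_prodI not_less)
    then show ?thesis using fm(1-3) by blast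
  qed
  then have "\<forall>n::nat. \<exists>f m. f \<in> F \<and> m \<in> M \<and> real (Suc n) < norm (\<pi> m) \<and> (\<forall>a b. (a, b) \<in> D \<longrightarrow> a \<bullet> (f + m) \<le> b + 1)"
    by blast
  then obtain f m where fm: "\<And>n. f n \<in> F" "\<And>n. m n \<in> M" "\<And>n::nat. real (Suc n) < norm (\<pi> (m n))"
    "\<And>n a b. (a, b) \<in> D \<Longrightarrow> a \<bullet> (f n + m n) \<le> b + 1"
    by metis
  have N0: "0 < norm (\<pi> (m n))" for n using fm(3)[of n] by (meson le_less_trans of_nat_0_le_iff)
  define d where "d n = (1 / norm (\<pi> (m n))) *\<^sub>R \<pi> (m n)" for n
  have dK: "d n \<in> \<pi> ` K" for n
    unfolding d_def using fm(2) nat_span_subset_cone[OF finG] by (intro \<pi>_K_scale imageI) auto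
  have "\<forall>n. d n \<in> sphere 0 1" using N0 by (simp add: d_def)
  then obtain l r where l: "l \<in> sphere 0 1" "strict_mono (r::nat\<Rightarrow>nat)" "(d \<circ> r) \<longlonglongrightarrow> l"
    using compact_sphere[of "0::'a" 1] unfolding compact_def by metis
  have "l \<in> \<pi> ` K" by (rule closed_sequentially[OF \<pi>_K_closed _ l(3)]) (simp add: dK)
  moreover have "l \<noteq> 0" using l(1) by auto
  ultimately obtain a b where ab: "(a, b) \<in> D" "0 < a \<bullet> l" using pos by blast
  \<comment> \<open>Bounds \<open>b + 1 - a \<bullet> f\<close> uniformly over the finite set
    \<open>F\<close>.\<close>
  define C where "C = \<bar>b\<bar> + 1 + (\<Sum>f\<in>F. \<bar>a \<bullet> f\<bar>)"
  have "C \<ge> 0" by (simp add: C_def sum_nonneg)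
  have bound: "a \<bullet> d n \<le> C * inverse (real (Suc n))" for n
  proof -
    have "a \<bullet> (m n - \<pi> (m n)) = 0" using orth[OF ab(1) diff_L] .
    then have "a \<bullet> \<pi> (m n) = a \<bullet> m n" by (simp add: inner_diff_right)
    also have "\<dots> \<le> b + 1 - a \<bullet> f n" using fm(4)[OF ab(1), of n] by (simp add: inner_add_right)
    also have "\<dots> \<le> C"
      using member_le_sum[of "f n" F "\<lambda>f. \<bar>a \<bullet> f\<bar>"] fm(1)[of n] assms(1) by (simp add: C_def)
    finally have "a \<bullet> \<pi> (m n) \<le> C" .
    then have "a \<bullet> d n \<le> C * (1 / norm (\<pi> (m n)))"
      using N0[of n] by (simp add: d_def divide_right_mono)
    also have "\<dots> \<le> C * inverse (real (Suc n))"
    proof -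
      have "1 / norm (\<pi> (m n)) \<le> 1 / real (Suc n)"
        using fm(3)[of n] by (intro divide_left_mono) (auto simp: N0 intro!: mult_pos_pos)
      then show ?thesis using \<open>C \<ge> 0\<close> by (intro mult_left_mono) (auto simp: inverse_eq_divide)
    qed
    finally show ?thesis .
  qed
  have 1: "(\<lambda>n. a \<bullet> (d \<circ> r) n) \<longlonglongrightarrow> a \<bullet> l" by (intro tendsto_intros l(3))
  have 2: "(\<lambda>n. C * inverse (real (Suc (r n)))) \<longlonglongrightarrow> 0"
    using LIMSEQ_subseq_LIMSEQ[OF tendsto_mult_right_zero[OF LIMSEQ_inverse_real_of_nat] l(2)]
    by (simp add: o_def)
  have "a \<bullet> l \<le> 0" by (rule LIMSEQ_le[OF 1 2]) (use bound in auto)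
  then show False using ab(2) by simp
qed

end

section \<open>The convex hull of a finitely generated set of points\<close>

locale finitely_generated_points =
  fixes F G S :: "'a::euclidean_space set"
  assumes finF: "finite F" and finG: "finite G" and F_nonempty: "F \<noteq> {}"
    and S_eq: "S = {f + u |f u. f \<in> F \<and> u \<in> nat_span G}"
begin

abbreviation "K \<equiv> convex_cone hull G"

lemma S_add: "s \<in> S \<Longrightarrow> u \<in> nat_span G \<Longrightarrow> s + u \<in> S"
proof -
  assume "s \<in> S" "u \<in> nat_span G"
  then obtain f v where "s = f + v" "f \<in> F" "v \<in> nat_span G" by (auto simp: S_eq)
  moreover have "s + u = f + (v + u)" using \<open>s = f + v\<close> by (simp add: add.assoc)
  moreover have "v + u \<in> nat_span G" using \<open>v \<in> nat_span G\<close> \<open>u \<in> nat_span G\<close> by (rule nat_span_add)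
  ultimately show ?thesis unfolding S_eq by blast
qed

lemma F_subset_S: "F \<subseteq> S"
proof
  fix f assume "f \<in> F"
  then have "f = f + 0" "f \<in> F" by auto
  then show "f \<in> S" unfolding S_eq using nat_span_0 by blast
qed

text \<open>\<open>S\<close> is invariant only under integer multiples of \<open>g\<close>; for real
  \<open>t\<close> the point \<open>s + t g\<close> lies on the segment from \<open>s\<close> to
  \<open>s + n g\<close> with an integer \<open>n > t\<close>.\<close>

lemma hull_add_generator:
  assumes "g \<in> G" "0 \<le> t" "x \<in> convex hull S"
  shows "x + t *\<^sub>R g \<in> convex hull S"
proof -
  have "convex ((+) (- (t *\<^sub>R g)) ` (convex hull S))"
    by (intro convex_translation convex_convex_hull)
  moreover have "S \<subseteq> (+) (- (t *\<^sub>R g)) ` (convex hull S)"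
  proof
    fix s assume "s \<in> S"
    \<comment> \<open>The summand 1 keeps the divisor \<open>n\<close> positive when
      \<open>t = 0\<close>.\<close>
    define n where "n = nat \<lceil>t\<rceil> + 1"
    have n: "t < real n" "0 < real n" using assms(2) by (simp_all add: n_def) linarith+
    have "s + real n *\<^sub>R g \<in> S"
      using \<open>s \<in> S\<close> assms(1) nat_span_base[OF finG] by (intro S_add nat_span_mult) auto
    then have "(1 - t / real n) *\<^sub>R s + (t / real n) *\<^sub>R (s + real n *\<^sub>R g) \<in> convex hull S"
      using \<open>s \<in> S\<close> n assms(2) by (intro convexD[OF convex_convex_hull]) (auto simp: hull_inc)
    then have "s + t *\<^sub>R g \<in> convex hull S" using n by (simp add: algebra_simps)
    then show "s \<in> (+) (- (t *\<^sub>R g)) ` (convex hull S)"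
      by (rule image_eqI[rotated]) simp
  qed
  ultimately have "convex hull S \<subseteq> (+) (- (t *\<^sub>R g)) ` (convex hull S)" by (rule hull_minimal[rotated])
  then obtain y where "y \<in> convex hull S" "x = - (t *\<^sub>R g) + y" using assms(3) by blast
  then show ?thesis by simp
qed

lemma hull_add_cone:
  assumes "k \<in> K" "x \<in> convex hull S"
  shows "x + k \<in> convex hull S"
proof -
  obtain c where c: "k = (\<Sum>g\<in>G. c g *\<^sub>R g)" "\<And>g. g \<in> G \<Longrightarrow> 0 \<le> c g"
    using assms(1) by (auto simp: convex_cone_hull_finite[OF finG])
  have "x + (\<Sum>g\<in>H. c g *\<^sub>R g) \<in> convex hull S" if "finite H" "H \<subseteq> G" for H
    using that
  proof (induction H)
    case (insert h H)
    then have "(x + (\<Sum>g\<in>H. c g *\<^sub>R g)) + c h *\<^sub>R h \<in> convex hull S"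
      using c(2) by (intro hull_add_generator) auto
    then show ?case using insert.hyps by (simp add: algebra_simps)
  qed (simp add: assms(2))
  then show ?thesis using finG c(1) by blast
qed

lemma hull_eq: "convex hull S = (\<Union>x\<in>convex hull F. \<Union>k\<in>K. {x + k})"
proof
  have "S \<subseteq> (\<Union>x\<in>convex hull F. \<Union>k\<in>K. {x + k})"
    using nat_span_subset_cone[OF finG] hull_subset[of F convex] by (auto simp: S_eq)
  then show "convex hull S \<subseteq> (\<Union>x\<in>convex hull F. \<Union>k\<in>K. {x + k})"
    by (intro hull_minimal convex_sums convex_convex_hull convex_convex_cone_hull)
  have "convex hull F \<subseteq> convex hull S" using F_subset_S by (rule hull_mono)
  then show "(\<Union>x\<in>convex hull F. \<Union>k\<in>K. {x + k}) \<subseteq> convex hull S"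
    using hull_add_cone by auto
qed

lemma closed_hull: "closed (convex hull S)"
  unfolding hull_eq
  by (intro compact_closed_sums compact_convex_hull finite_imp_compact finF closed_convex_cone_hull finG)

text \<open>Write \<open>f0 + n r\<close> as a point of the compact set \<open>convex hull F\<close>
  plus a point of \<open>K\<close> and divide by \<open>n\<close>: the bounded part vanishes, and
  \<open>r\<close> is a limit of points of the closed cone.\<close>

lemma recession_hull: "recession_cone (convex hull S) = K"
proof
  show "K \<subseteq> recession_cone (convex hull S)"
    unfolding recession_cone_def by (auto intro!: hull_add_cone convex_cone_hull_mul)
  show "recession_cone (convex hull S) \<subseteq> K"
  proof
    fix r assume r: "r \<in> recession_cone (convex hull S)"
    obtain f0 where f0: "f0 \<in> convex hull S" using F_nonempty F_subset_S by (meson all_not_in_conv hull_inc subsetD)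
    have "\<forall>n::nat. \<exists>x k. x \<in> convex hull F \<and> k \<in> K \<and> f0 + real (Suc n) *\<^sub>R r = x + k"
    proof
      fix n
      have "f0 + real (Suc n) *\<^sub>R r \<in> convex hull S"
        using r f0 unfolding recession_cone_def by (simp del: of_nat_Suc)
      then show "\<exists>x k. x \<in> convex hull F \<and> k \<in> K \<and> f0 + real (Suc n) *\<^sub>R r = x + k"
        unfolding hull_eq by blast
    qed
    then obtain x k where xk: "\<And>n. x n \<in> convex hull F" "\<And>n. k n \<in> K"
      "\<And>n::nat. f0 + real (Suc n) *\<^sub>R r = x n + k n" by metis
    have "bounded (convex hull F)"
      by (intro compact_imp_bounded compact_convex_hull finite_imp_compact finF)
    then obtain C where C: "\<And>x. x \<in> convex hull F \<Longrightarrow> norm x \<le> C" unfolding bounded_iff by blast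
    define u where "u n = inverse (real (Suc n))" for n
    have ku: "u n *\<^sub>R k n = r + u n *\<^sub>R (f0 - x n)" for n
    proof -
      have "k n = real (Suc n) *\<^sub>R r + (f0 - x n)" using xk(3)[of n] by (simp add: algebra_simps)
      then have "u n *\<^sub>R k n = (u n * real (Suc n)) *\<^sub>R r + u n *\<^sub>R (f0 - x n)"
        by (simp only: scaleR_right_distrib scaleR_scaleR)
      then show ?thesis by (simp add: u_def del: of_nat_Suc)
    qed
    have "norm (u n *\<^sub>R (f0 - x n)) \<le> u n * (norm f0 + C)" for n
    proof -
      have "norm (f0 - x n) \<le> norm f0 + C" using norm_triangle_ineq4[of f0 "x n"] C[OF xk(1)[of n]] by linarith
      then show ?thesis by (simp add: u_def mult_left_mono)
    qed
    then have "\<forall>\<^sub>F n in sequentially. norm (u n *\<^sub>R (f0 - x n)) \<le> u n * (norm f0 + C)"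
      by (intro always_eventually allI)
    moreover have "(\<lambda>n. u n * (norm f0 + C)) \<longlonglongrightarrow> 0"
      unfolding u_def using tendsto_mult_left_zero[OF LIMSEQ_inverse_real_of_nat] .
    ultimately have "(\<lambda>n. u n *\<^sub>R (f0 - x n)) \<longlonglongrightarrow> 0" by (rule Lim_null_comparison)
    from tendsto_add[OF tendsto_const[of r] this]
    have lim: "(\<lambda>n. u n *\<^sub>R k n) \<longlonglongrightarrow> r" by (simp add: ku)
    have "u n *\<^sub>R k n \<in> K" for n using xk(2) by (intro convex_cone_hull_mul) (auto simp: u_def)
    then show "r \<in> K" by (rule closed_sequentially[OF closed_convex_cone_hull[OF finG] _ lim])
  qed
qed

text \<open>Lattice points of \<open>S\<close> come arbitrarily close to every ray \<open>y + q r\<close>, which runs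
  inside \<open>B\<close> at a fixed distance from the complement.\<close>

lemma maximal_recession:
  assumes max: "maximal_free_convex S B" and int: "interior B \<noteq> {}"
    and r: "r \<in> recession_cone B" "r \<in> K"
  shows "r \<in> lineality_space B"
proof (rule maximal_free_convex_line[OF max int])
  fix y t assume y: "y \<in> S"
  show "y + t *\<^sub>R r \<notin> interior B"
  proof
    assume "y + t *\<^sub>R r \<in> interior B"
    then obtain e where e: "0 < e" "ball (y + t *\<^sub>R r) e \<subseteq> B" using mem_interior by blast
    obtain c where c: "r = (\<Sum>g\<in>G. c g *\<^sub>R g)" "\<And>g. g \<in> G \<Longrightarrow> 0 \<le> c g"
      using r(2) by (auto simp: convex_cone_hull_finite[OF finG])
    define C where "C = (\<Sum>g\<in>G. norm g) + 1"
    have C: "0 < C" "(\<Sum>g\<in>G. norm g) < C" using sum_nonneg[of G norm] by (auto simp: C_def)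
    have \<delta>: "0 < e / C" using e(1) C(1) by simp
    \<comment> \<open>Since \<open>q\<close> is at least \<open>t\<close>, the ball of radius
      \<open>e\<close> around \<open>y + q r\<close> is the ball around \<open>y + t r\<close> moved
      along a recession direction, so it stays in \<open>B\<close>.\<close>
    obtain q p where q: "nat \<lceil>t\<rceil> \<le> q" "\<And>g. g \<in> G \<Longrightarrow> \<bar>real (p g) - real q * c g\<bar> < e / C"
      by (rule simultaneous_approximation[OF finG _ \<delta>, where c = c and N = "nat \<lceil>t\<rceil>"]) (use c(2) in auto)
    define u where "u = (\<Sum>g\<in>G. real (p g) *\<^sub>R g)"
    have "u - real q *\<^sub>R r = (\<Sum>g\<in>G. (real (p g) - real q * c g) *\<^sub>R g)"
      by (simp add: u_def c(1) scaleR_left_diff_distrib sum_subtractf scaleR_sum_right)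
    then have "norm (u - real q *\<^sub>R r) \<le> e / C * (\<Sum>g\<in>G. norm g)"
      using norm_weighted_sum_le[OF finG, of _ "e / C" "\<lambda>g. g"] q(2) by (simp add: less_imp_le)
    also have "\<dots> < e" using mult_strict_left_mono[OF C(2) \<delta>] C(1) by simp
    finally have ur: "norm (u - real q *\<^sub>R r) < e" .
    have tq: "t \<le> real q" using q(1) by linarith
    have "ball (y + real q *\<^sub>R r) e \<subseteq> B"
    proof
      fix z assume "z \<in> ball (y + real q *\<^sub>R r) e"
      then have "z - (real q - t) *\<^sub>R r \<in> ball (y + t *\<^sub>R r) e"
        by (simp add: dist_norm algebra_simps)
      then have "z - (real q - t) *\<^sub>R r \<in> B" using e(2) by blast
      moreover have "0 \<le> real q - t" using tq by simp
      ultimately have "(z - (real q - t) *\<^sub>R r) + (real q - t) *\<^sub>R r \<in> B"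
        using r(1) unfolding recession_cone_def by blast
      then show "z \<in> B" by simp
    qed
    then have "ball (y + real q *\<^sub>R r) e \<subseteq> interior B" by (simp add: interior_maximal)
    moreover have "y + u \<in> ball (y + real q *\<^sub>R r) e"
      using ur by (simp add: dist_norm norm_minus_commute)
    ultimately have "y + u \<in> interior B" by blast
    moreover have "y + u \<in> S" using y nat_spanI by (auto simp: u_def intro: S_add)
    ultimately show False using max by (auto simp: maximal_free_convex_def free_convex_def)
  qed
qed

text \<open>The line from \<open>line_of_tiny\<close> is only approximated by \<open>M + L\<close>;
  the open interior of \<open>B\<close> absorbs the error and its invariance under the lineality
  space absorbs the summand from \<open>L\<close>. So no translate of the line through a point of
  \<open>S\<close> meets the interior.\<close>

lemma maximal_discrete:
  assumes max: "maximal_free_convex S B" and int: "interior B \<noteq> {}"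
    and mm: "monoid_mod_subspace G (lineality_space B) \<pi>"
  shows "monoid_mod_subspace.discrete_mod G (lineality_space B) \<pi>"
proof -
  interpret mm: monoid_mod_subspace G "lineality_space B" \<pi> by fact
  show ?thesis
  proof (rule ccontr)
    assume "\<not> mm.discrete_mod"
    then obtain d where d: "d \<notin> lineality_space B" "\<And>t. t *\<^sub>R d \<in> mm.A"
      using mm.line_of_tiny by blast
    have "d \<in> lineality_space B"
    proof (rule maximal_free_convex_line[OF max int])
      fix y t assume y: "y \<in> S"
      show "y + t *\<^sub>R d \<notin> interior B"
      proof
        assume "y + t *\<^sub>R d \<in> interior B"
        then obtain e where e: "0 < e" "ball (y + t *\<^sub>R d) e \<subseteq> interior B"
          using open_contains_ball open_interior by blast
        obtain m l where ml: "m \<in> nat_span G" "l \<in> lineality_space B" "dist (m + l) (t *\<^sub>R d) < e"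
          using d(2)[of t] e(1) unfolding mm.A_def closure_approachable by blast
        have "y + (m + l) \<in> interior B"
          using ml(3) e(2) by (auto simp: dist_norm norm_minus_commute)
        then have "(y + (m + l)) + (- l) \<in> interior B"
          using subspace_neg[OF subspace_lineality ml(2)] by (rule interior_lineality)
        then have "y + m \<in> interior B" by (simp add: add.assoc)
        moreover have "y + m \<in> S" using S_add y ml(1) by blast
        ultimately show False using max by (auto simp: maximal_free_convex_def free_convex_def)
      qed
    qed
    then show False using d(1) by blast
  qed
qed

end

section \<open>Maximal S-free convex sets\<close>

text \<open>The cap \<open>e \<le> 1\<close> keeps the enlarged sets within the unit range for which
  finiteness of the values is known.\<close>

lemma finite_gap_above:
  fixes T :: "real set"
  assumes "finite T" "\<And>t. t \<in> T \<Longrightarrow> b < t"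
  obtains e where "0 < e" "e \<le> 1" "\<And>t. t \<in> T \<Longrightarrow> b + e \<le> t"
proof (cases "T = {}")
  case True
  then show ?thesis using that[of 1] by simp
next
  case False
  then have "b < Min T" using assms by simp
  then show ?thesis
    using assms by (intro that[of "min 1 (Min T - b)"]) (auto simp: min_le_iff_disj min_def dest: Min_le)
qed

text \<open>A nonempty interior makes the affine hull the whole space, so facets and interior are
  read off an irredundant system. Irredundancy provides for each \<open>h\<close> a point that
  violates \<open>h\<close> alone.\<close>

lemma polyhedron_irredundant:
  fixes B :: "'a::euclidean_space set"
  assumes "polyhedron B" "interior B \<noteq> {}"
  obtains H :: "'a set set" and a b where "finite H" "B = {x. \<forall>h\<in>H. a h \<bullet> x \<le> b h}"
    "interior B = {x. \<forall>h\<in>H. a h \<bullet> x < b h}"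
    "\<forall>C. C facet_of B \<longleftrightarrow> (\<exists>h. h \<in> H \<and> C = B \<inter> {x. a h \<bullet> x = b h})"
    "\<forall>h\<in>H. a h \<noteq> 0"
    "\<forall>h\<in>H. \<exists>z. b h < a h \<bullet> z \<and> (\<forall>i\<in>H - {h}. a i \<bullet> z \<le> b i)"
proof -
  have aff: "affine hull B = UNIV" using assms(2) by (rule affine_hull_nonempty_interior)
  obtain H :: "'a set set" where H: "finite H" "B = \<Inter>H"
    "\<forall>h\<in>H. \<exists>a b. a \<noteq> 0 \<and> h = {x. a \<bullet> x \<le> b}" "\<And>F'. F' \<subset> H \<Longrightarrow> B \<subset> \<Inter>F'"
    using assms(1) unfolding polyhedron_Int_affine_minimal aff by (metis Int_UNIV_left)
  obtain a b where ab: "\<And>h. h \<in> H \<Longrightarrow> a h \<noteq> 0 \<and> h = {x. a h \<bullet> x \<le> b h}"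
    using H(3) by metis
  have in_h: "x \<in> h \<longleftrightarrow> a h \<bullet> x \<le> b h" if "h \<in> H" for h x
    using ab[OF that] by auto
  have B_eq: "B = affine hull B \<inter> \<Inter>H" using H(2) aff by simp
  have B_min: "B \<subset> affine hull B \<inter> \<Inter>F'" if "F' \<subset> H" for F' using H(4)[OF that] aff by simp
  have r1: "B = {x. \<forall>h\<in>H. a h \<bullet> x \<le> b h}" using H(2) in_h by auto
  have r2: "interior B = {x. \<forall>h\<in>H. a h \<bullet> x < b h}"
  proof -
    have "rel_interior B = {x \<in> B. \<forall>h\<in>H. a h \<bullet> x < b h}"
      by (rule rel_interior_polyhedron_explicit[OF H(1) B_eq ab B_min])
    then show ?thesis
      using rel_interior_nonempty_interior[OF assms(2)] r1 by (auto intro: less_imp_le)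
  qed
  have r3: "C facet_of B \<longleftrightarrow> (\<exists>h. h \<in> H \<and> C = B \<inter> {x. a h \<bullet> x = b h})" for C
    by (rule facet_of_polyhedron_explicit[OF H(1) B_eq ab B_min])
  have r4: "\<exists>z. b h < a h \<bullet> z \<and> (\<forall>i\<in>H - {h}. a i \<bullet> z \<le> b i)" if h: "h \<in> H" for h
  proof -
    have "B \<subset> \<Inter>(H - {h})" using h by (intro H(4)) auto
    then obtain z where z: "z \<in> \<Inter>(H - {h})" "z \<notin> \<Inter>H" using H(2) by blast
    then have "z \<notin> h" by auto
    then show ?thesis using z(1) in_h h by (intro exI[of _ z]) (auto simp: not_le)
  qed
  have r5: "a h \<noteq> 0" if "h \<in> H" for h using ab[OF that] by blast
  show ?thesis using that[OF H(1) r1 r2] r3 r4 r5 by blast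
qed

text \<open>A point \<open>c\<close> of a larger set violates some inequality \<open>h\<close>.
  Prolonging the segment from \<open>c\<close> through the point \<open>y \<in> S\<close> of that
  facet enters the interior of \<open>B\<close>, so \<open>y\<close> lies strictly between
  \<open>c\<close> and an interior point of the larger set and is itself interior.\<close>

lemma maximal_of_facet_points:
  fixes B :: "'a::euclidean_space set"
  assumes poly: "polyhedron B" and int: "interior B \<noteq> {}" and free: "interior B \<inter> S = {}"
    and facets: "\<And>C. C facet_of B \<Longrightarrow> rel_interior C \<inter> S \<noteq> {}"
  shows "maximal_free_convex S B"
proof -
  have convB: "convex B" using poly by (rule polyhedron_imp_convex)
  obtain H :: "'a set set" and a b where H0: "finite H" "B = {x. \<forall>h\<in>H. a h \<bullet> x \<le> b h}"
    "interior B = {x. \<forall>h\<in>H. a h \<bullet> x < b h}"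
    "\<forall>C. C facet_of B \<longleftrightarrow> (\<exists>h. h \<in> H \<and> C = B \<inter> {x. a h \<bullet> x = b h})"
    "\<forall>h\<in>H. a h \<noteq> 0"
    "\<forall>h\<in>H. \<exists>z. b h < a h \<bullet> z \<and> (\<forall>i\<in>H - {h}. a i \<bullet> z \<le> b i)"
    by (rule polyhedron_irredundant[OF poly int])
  note H = H0(1-3) H0(4-6)[rule_format]
  obtain z0 where z0: "\<And>i. i \<in> H \<Longrightarrow> a i \<bullet> z0 < b i" using int H(3) by auto
  have "\<not> B \<subset> C" if C: "free_convex S C" for C
  proof
    assume BC: "B \<subset> C"
    then obtain c where c: "c \<in> C" "c \<notin> B" by blast
    then obtain h where h: "h \<in> H" "b h < a h \<bullet> c" using H(2) by (auto simp: not_le)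
    define F where "F = B \<inter> {x. a h \<bullet> x = b h}"
    have "F facet_of B" using H(4) h(1) F_def by blast
    then obtain y where y: "y \<in> rel_interior F" "y \<in> S" using facets by blast
    have yF: "y \<in> F" using y(1) rel_interior_subset by blast
    \<comment> \<open>A second tight inequality at a relative interior point would be tight on the
      whole facet; the point \<open>q\<close> of the facet, where only \<open>h\<close> is tight,
      excludes this.\<close>
    have strict: "a i \<bullet> y < b i" if i: "i \<in> H - {h}" for i
    proof (rule ccontr)
      assume "\<not> ?thesis"
      then have yi: "a i \<bullet> y = b i" using yF i H(2) by (force simp: F_def)
      obtain z where z: "b h < a h \<bullet> z" "\<forall>i\<in>H - {h}. a i \<bullet> z \<le> b i" using H(6)[OF h(1)] by blast
      \<comment> \<open>The parameter at which the segment from the interior point \<open>z0\<close>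
        to \<open>z\<close> crosses the hyperplane of \<open>h\<close>.\<close>
      define \<theta> where "\<theta> = (b h - a h \<bullet> z0) / (a h \<bullet> z - a h \<bullet> z0)"
      have den: "0 < a h \<bullet> z - a h \<bullet> z0" using z0[OF h(1)] z(1) by simp
      have \<theta>: "0 < \<theta>" "\<theta> < 1" "\<theta> * (a h \<bullet> z - a h \<bullet> z0) = b h - a h \<bullet> z0"
        using z0[OF h(1)] z(1) den by (auto simp: \<theta>_def)
      define q where "q = (1 - \<theta>) *\<^sub>R z0 + \<theta> *\<^sub>R z"
      have aq: "x \<bullet> q = (1 - \<theta>) * (x \<bullet> z0) + \<theta> * (x \<bullet> z)" for x by (simp add: q_def inner_add_right)
      have "a h \<bullet> q = b h" using \<theta>(3) unfolding aq by (simp add: algebra_simps)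
      have lt: "a j \<bullet> q < b j" if "j \<in> H - {h}" for j
      proof -
        have "(1 - \<theta>) * (a j \<bullet> z0) < (1 - \<theta>) * b j" using z0[of j] that \<theta>(2) by simp
        moreover have "\<theta> * (a j \<bullet> z) \<le> \<theta> * b j" using z(2) that \<theta>(1) by simp
        ultimately show ?thesis unfolding aq by (simp add: algebra_simps)
      qed
      have "a j \<bullet> q \<le> b j" if "j \<in> H" for j
        using lt[of j] \<open>a h \<bullet> q = b h\<close> that by (cases "j = h") auto
      then have "q \<in> F" using \<open>a h \<bullet> q = b h\<close> H(2) by (auto simp: F_def)
      have "convex F" unfolding F_def by (intro convex_Int convB convex_hyperplane)
      then obtain e where e: "1 < e" "(1 - e) *\<^sub>R q + e *\<^sub>R y \<in> F"
        using convex_rel_interior_iff[of F y] y(1) \<open>q \<in> F\<close> by blast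
      then have "(1 - e) *\<^sub>R q + e *\<^sub>R y \<in> B" by (simp add: F_def)
      then have "a i \<bullet> ((1 - e) *\<^sub>R q + e *\<^sub>R y) \<le> b i" using H(2) i by blast
      then have "(e - 1) * (b i - a i \<bullet> q) \<le> 0" by (simp add: inner_add_right yi algebra_simps)
      then show False using e(1) lt[OF i] by (simp add: mult_le_0_iff)
    qed
    have "open (\<Inter>i\<in>H - {h}. {x. a i \<bullet> x < b i})"
      using H(1) by (intro open_INT) (auto simp: open_halfspace_lt)
    moreover have "y \<in> (\<Inter>i\<in>H - {h}. {x. a i \<bullet> x < b i})" using strict by auto
    ultimately obtain e where e: "0 < e" "ball y e \<subseteq> (\<Inter>i\<in>H - {h}. {x. a i \<bullet> x < b i})"
      by (rule openE)
    \<comment> \<open>The prolongation beyond \<open>y\<close> is short enough to keep the other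
      inequalities strict.\<close>
    define t where "t = e / 2 / (norm (y - c) + 1)"
    have N: "0 < norm (y - c) + 1" by (simp add: add_nonneg_pos)
    then have "0 < t" using e(1) by (simp add: t_def)
    have "t * norm (y - c) \<le> t * (norm (y - c) + 1)" using \<open>0 < t\<close> by simp
    also have "\<dots> = e / 2" using N unfolding t_def by (simp only: nonzero_divide_eq_eq times_divide_eq_left)
    finally have tn: "t * norm (y - c) < e" using e(1) by simp
    define w where "w = y + t *\<^sub>R (y - c)"
    have "w \<in> ball y e" using tn \<open>0 < t\<close> by (simp add: w_def dist_norm)
    then have "a i \<bullet> w < b i" if "i \<in> H - {h}" for i using e(2) that by blast
    moreover have "a h \<bullet> w < b h"
    proof -
      have "a h \<bullet> w = b h - t * (a h \<bullet> c - b h)"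
        using yF by (simp add: w_def F_def inner_add_right inner_diff_right algebra_simps)
      then show ?thesis using \<open>0 < t\<close> h(2) by simp
    qed
    ultimately have "w \<in> interior B" using H(3) by blast
    then have "w \<in> interior C" using BC interior_mono by blast
    moreover have "convex C" using C by (simp add: free_convex_def)
    ultimately have "c - (1 / (1 + t)) *\<^sub>R (c - w) \<in> interior C"
      using c(1) \<open>0 < t\<close> by (intro mem_interior_convex_shrink) auto
    moreover have "c - w = (1 + t) *\<^sub>R (c - y)" by (simp add: w_def algebra_simps)
    then have "c - (1 / (1 + t)) *\<^sub>R (c - w) = y" using \<open>0 < t\<close> by simp
    ultimately show False using y(2) C by (auto simp: free_convex_def)
  qed
  then show ?thesis
    using convB free by (auto simp: maximal_free_convex_def free_convex_def)
qed

lemma closed_halfspace_of_interior: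
  fixes C :: "'a::euclidean_space set"
  assumes "convex C" "interior C \<noteq> {}" "\<And>x. x \<in> interior C \<Longrightarrow> a \<bullet> x \<le> b" "x \<in> C"
  shows "a \<bullet> x \<le> b"
proof -
  have "closure (interior C) \<subseteq> {x. a \<bullet> x \<le> b}"
    using assms(3) by (intro closure_minimal closed_halfspace_le) auto
  then show ?thesis
    using convex_closure_interior[OF assms(1,2)] closure_subset assms(4) by blast
qed

text \<open>A convex set containing the half-space and a point \<open>c\<close> beyond it contains
  the open half-space up to the level of \<open>c\<close>, and \<open>s\<close> is interior to
  that.\<close>

lemma halfspace_is_maximal:
  fixes a :: "'a::euclidean_space"
  assumes "a \<noteq> 0" "\<And>s. s \<in> S \<Longrightarrow> b \<le> a \<bullet> s" "s \<in> S" "a \<bullet> s = b"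
  shows "maximal_free_convex S {x. a \<bullet> x \<le> b}"
proof -
  have "\<not> {x. a \<bullet> x \<le> b} \<subset> C" if C: "free_convex S C" for C
  proof
    assume sub: "{x. a \<bullet> x \<le> b} \<subset> C"
    then obtain c where c: "c \<in> C" "c \<notin> {x. a \<bullet> x \<le> b}" by blast
    then have c: "c \<in> C" "b < a \<bullet> c" by auto
    have "{x. a \<bullet> x < a \<bullet> c} \<subseteq> C"
    proof
      fix x assume "x \<in> {x. a \<bullet> x < a \<bullet> c}"
      then have x: "a \<bullet> x < a \<bullet> c" by simp
      \<comment> \<open>Dilation with centre \<open>c\<close> and factor \<open>t\<close> takes
        \<open>x\<close> to the point \<open>y\<close> of the half-space.\<close>
      define t where "t = 1 + \<bar>a \<bullet> x - b\<bar> / (a \<bullet> c - a \<bullet> x)"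
      have t: "1 \<le> t" "a \<bullet> x - b \<le> (t - 1) * (a \<bullet> c - a \<bullet> x)" using x by (auto simp: t_def)
      define y where "y = x + (t - 1) *\<^sub>R (x - c)"
      have "a \<bullet> y \<le> b" using t(2) by (simp add: y_def inner_add_right inner_diff_right algebra_simps)
      then have "y \<in> C" using sub by blast
      moreover have "x = (1 / t) *\<^sub>R y + (1 - 1 / t) *\<^sub>R c"
      proof -
        have "y = t *\<^sub>R x - (t - 1) *\<^sub>R c" by (simp add: y_def algebra_simps)
        then have "(1 / t) *\<^sub>R y = x - (1 / t * (t - 1)) *\<^sub>R c" using t(1) by (simp add: scaleR_diff_right)
        moreover have "1 / t * (t - 1) = 1 - 1 / t" using t(1) by (simp add: field_simps)
        ultimately show ?thesis by simp
      qed
      ultimately show "x \<in> C"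
        using C c(1) t(1) convexD[of C y c "1 / t" "1 - 1 / t"] by (auto simp: free_convex_def)
    qed
    then have "{x. a \<bullet> x < a \<bullet> c} \<subseteq> interior C" by (simp add: interior_maximal open_halfspace_lt)
    then have "s \<in> interior C" using assms(4) c(2) by auto
    then show False using C assms(3) by (auto simp: free_convex_def)
  qed
  moreover have "free_convex S {x. a \<bullet> x \<le> b}"
    using assms(1,2) by (auto simp: free_convex_def convex_halfspace_le) (meson leD)
  ultimately show ?thesis by (simp add: maximal_free_convex_def)
qed

section \<open>Maximal sets with nonempty interior and maximal hyperplanes\<close>

context finitely_generated_points
begin

text \<open>\<open>d\<close> differs from an element \<open>k\<close> of \<open>K\<close> by a
  lineality direction, so \<open>k\<close> is a recession direction and
  \<open>maximal_recession\<close> makes it a lineality direction. Hence every nonzero direction of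
  the projected cone leaves \<open>B\<close>, as \<open>far_points_violate\<close> requires.\<close>

lemma recession_projection_trivial:
  assumes max: "maximal_free_convex S B" and int: "interior B \<noteq> {}"
    and mm: "monoid_mod_subspace G (lineality_space B) \<pi>"
    and d: "d \<in> \<pi> ` K" "d \<in> recession_cone B"
  shows "d = 0"
proof -
  interpret mm: monoid_mod_subspace G "lineality_space B" \<pi> by fact
  obtain k where k: "k \<in> K" "d = \<pi> k" using d(1) by blast
  have "k - d \<in> recession_cone B" using mm.diff_L[of k] k(2) lineality_subset_recession by blast
  from recession_cone_add[OF d(2) this] have "k \<in> recession_cone B" by simp
  then have "k \<in> lineality_space B" using maximal_recession[OF max int] k(1) by blast
  then show ?thesis using mm.\<pi>_L k(2) by simp
qed

text \<open>Modulo the lineality space only finitely many points of \<open>S\<close> are near \<open>B\<close>: they are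
  separated one by one, and the distant ones by the finitely many halfspaces that a compactness
  argument in the directions of the projected recession cone yields.\<close>

lemma maximal_polyhedron:
  assumes max: "maximal_free_convex S B" and int: "interior B \<noteq> {}"
  shows "polyhedron B"
proof -
  let ?L = "lineality_space B"
  have convB: "convex B" and free: "interior B \<inter> S = {}"
    using max by (auto simp: maximal_free_convex_def free_convex_def)
  have B0: "B \<noteq> {}" using int interior_subset by blast
  obtain \<pi> :: "'a \<Rightarrow> 'a" where \<pi>0: "linear \<pi>" "\<forall>x. x - \<pi> x \<in> ?L" "\<forall>x\<in>?L. \<pi> x = 0"
    by (rule subspace_projection_exists[OF subspace_lineality])
  note \<pi> = \<pi>0(1) \<pi>0(2,3)[rule_format]
  have mm: "monoid_mod_subspace G ?L \<pi>"
    using finG subspace_lineality \<pi> by (intro monoid_mod_subspace.intro)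
  interpret mm: monoid_mod_subspace G ?L \<pi> by (rule mm)
  have fin: "finite (\<pi> ` nat_span G \<inter> cball 0 R)" for R
    by (intro mm.finite_mod maximal_discrete[OF max int mm])
  have "\<exists>a b. (\<forall>x\<in>B. a \<bullet> x \<le> b) \<and> 0 < a \<bullet> d" if d: "d \<in> \<pi> ` K \<inter> sphere 0 1" for d
  proof -
    have "d \<notin> recession_cone B" using recession_projection_trivial[OF max int mm, of d] d by auto
    then show ?thesis
      using not_recession_separation[OF maximal_free_convex_closed[OF max] convB, of d] by metis
  qed
  then obtain a b where ab: "\<And>d x. d \<in> \<pi> ` K \<inter> sphere 0 1 \<Longrightarrow> x \<in> B \<Longrightarrow> a d \<bullet> x \<le> b d"
    "\<And>d. d \<in> \<pi> ` K \<inter> sphere 0 1 \<Longrightarrow> 0 < a d \<bullet> d" by metis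
  have comp: "compact (\<pi> ` K \<inter> sphere 0 1)"
    by (intro closed_Int_compact mm.\<pi>_K_closed compact_sphere)
  obtain E where E: "E \<subseteq> \<pi> ` K \<inter> sphere 0 1" "finite E"
    "\<pi> ` K \<inter> sphere 0 1 \<subseteq> (\<Union>d\<in>E. {x. 0 < a d \<bullet> x})"
  proof (rule compactE_image[OF comp, of "\<pi> ` K \<inter> sphere 0 1" "\<lambda>d. {x. 0 < a d \<bullet> x}"])
    show "open {x. 0 < a d \<bullet> x}" for d by (rule open_halfspace_gt)
    show "\<pi> ` K \<inter> sphere 0 1 \<subseteq> (\<Union>d\<in>\<pi> ` K \<inter> sphere 0 1. {x. 0 < a d \<bullet> x})" using ab(2) by blast
  qed (use that in auto)
  define D where "D = (\<lambda>d. (a d, b d)) ` E"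
  have D: "p \<noteq> 0" "\<forall>x\<in>B. p \<bullet> x \<le> q" if "(p, q) \<in> D" for p q
    using that E(1) ab unfolding D_def by force+
  have "\<exists>R. \<forall>f\<in>F. \<forall>m\<in>nat_span G. R < norm (\<pi> m) \<longrightarrow> (\<exists>(p, q)\<in>D. q + 1 < p \<bullet> (f + m))"
  proof (rule mm.far_points_violate[OF finF])
    show "p \<bullet> l = 0" if "(p, q) \<in> D" "l \<in> ?L" for p q l
      using valid_inequality_lineality[OF B0, of p q l] D(2)[OF that(1)] that(2) by blast
    fix d assume d: "d \<in> \<pi> ` K" "d \<noteq> 0"
    have "(1 / norm d) *\<^sub>R d \<in> \<pi> ` K \<inter> sphere 0 1" using d mm.\<pi>_K_scale by auto
    then obtain e where "e \<in> E" "0 < a e \<bullet> ((1 / norm d) *\<^sub>R d)" using E(3) by blast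
    then have "0 < a e \<bullet> d" using d(2) by (simp add: zero_less_divide_iff)
    then show "\<exists>(p, q)\<in>D. 0 < p \<bullet> d" using \<open>e \<in> E\<close> by (auto simp: D_def)
  qed
  then obtain R where R: "\<And>f m. f \<in> F \<Longrightarrow> m \<in> nat_span G \<Longrightarrow> R < norm (\<pi> m) \<Longrightarrow>
      \<exists>(p, q)\<in>D. q + 1 < p \<bullet> (f + m)" by blast
  define Q where "Q = F \<times> (\<pi> ` nat_span G \<inter> cball 0 R)"
  have "finite Q" unfolding Q_def using finF fin by blast
  \<comment> \<open>The right-hand side is the value of \<open>p\<close> at one point of
    \<open>S\<close> with these data. As \<open>p\<close> is constant along the lineality space, one
    inequality serves all points of \<open>S\<close> with the same pair.\<close>
  have "\<exists>p s. p \<noteq> 0 \<and> (\<forall>x\<in>B. p \<bullet> x \<le> p \<bullet> s) \<and> (\<exists>m. s = fst fv + m \<and> \<pi> m = snd fv)"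
    if fv: "fv \<in> Q" for fv
  proof -
    obtain f m where m: "fv = (f, \<pi> m)" "f \<in> F" "m \<in> nat_span G" using fv by (auto simp: Q_def)
    have "f + m \<in> S" using m by (auto simp: S_eq)
    then have "interior B \<inter> {f + m} = {}" using free by blast
    then obtain p q where p: "p \<noteq> 0" "\<forall>x\<in>interior B. p \<bullet> x \<le> q" "q \<le> p \<bullet> (f + m)"
      using separating_hyperplane_sets[OF convex_interior[OF convB] convex_singleton int] by blast
    have "\<forall>x\<in>B. p \<bullet> x \<le> p \<bullet> (f + m)"
      using closed_halfspace_of_interior[OF convB int, of p "p \<bullet> (f + m)"] p(2,3) by fastforce
    then show ?thesis using p(1) m(1) by (intro exI[of _ p] exI[of _ "f + m"]) auto
  qed
  then obtain p s where ps: "\<And>fv. fv \<in> Q \<Longrightarrow> p fv \<noteq> 0" "\<And>fv x. fv \<in> Q \<Longrightarrow> x \<in> B \<Longrightarrow> p fv \<bullet> x \<le> p fv \<bullet> s fv"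
    "\<And>fv. fv \<in> Q \<Longrightarrow> \<exists>m. s fv = fst fv + m \<and> \<pi> m = snd fv" by metis
  define I where "I = D \<union> (\<lambda>fv. (p fv, p fv \<bullet> s fv)) ` Q"
  have finI: "finite I" using E(2) \<open>finite Q\<close> by (simp add: I_def D_def)
  have I: "u \<noteq> 0 \<and> (\<forall>x\<in>B. u \<bullet> x \<le> v)" if "(u, v) \<in> I" for u v
    using that D ps(1,2) unfolding I_def by auto
  have sep: "\<exists>(u, v)\<in>I. v \<le> u \<bullet> y" if y: "y \<in> S" for y
  proof -
    obtain f m where fm: "y = f + m" "f \<in> F" "m \<in> nat_span G" using y by (auto simp: S_eq)
    show ?thesis
    proof (cases "R < norm (\<pi> m)")
      case True
      then obtain u v where "(u, v) \<in> D" "v + 1 < u \<bullet> y" using R[OF fm(2,3)] fm(1) by blast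
      then show ?thesis by (intro bexI[of _ "(u, v)"]) (auto simp: I_def)
    next
      case False
      then have fv: "(f, \<pi> m) \<in> Q" using fm by (auto simp: Q_def)
      obtain m' where m': "s (f, \<pi> m) = f + m'" "\<pi> m' = \<pi> m" using ps(3)[OF fv] by auto
      have "\<pi> (m - m') = 0" using m'(2) by (simp add: linear_diff[OF \<pi>(1)])
      then have "m - m' \<in> ?L" by (simp add: mm.\<pi>_eq_0)
      then have "p (f, \<pi> m) \<bullet> (m - m') = 0"
        using valid_inequality_lineality[OF B0, of "p (f, \<pi> m)" "p (f, \<pi> m) \<bullet> s (f, \<pi> m)"] ps(2)[OF fv]
        by blast
      then have "p (f, \<pi> m) \<bullet> y = p (f, \<pi> m) \<bullet> s (f, \<pi> m)"
        by (simp add: fm(1) m'(1) inner_add_right inner_diff_right)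
      then show ?thesis using fv unfolding I_def by (intro bexI[of _ "(p (f, \<pi> m), p (f, \<pi> m) \<bullet> s (f, \<pi> m))"]) auto
    qed
  qed
  define C where "C = (\<Inter>(u, v)\<in>I. {x. u \<bullet> x \<le> v})"
  have polyC: "polyhedron C"
    unfolding C_def using finI by (intro polyhedron_Inter) (auto simp: polyhedron_halfspace_le)
  have "free_convex S C"
    unfolding free_convex_def
  proof
    show "convex C" using polyC by (rule polyhedron_imp_convex)
    show "interior C \<inter> S = {}"
    proof (rule ccontr)
      assume "\<not> ?thesis"
      then obtain y where y: "y \<in> interior C" "y \<in> S" by blast
      obtain u v where uv: "(u, v) \<in> I" "v \<le> u \<bullet> y" using sep[OF y(2)] by blast
      have "C \<subseteq> {x. u \<bullet> x \<le> v}" using uv(1) by (auto simp: C_def)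
      then have "y \<in> interior {x. u \<bullet> x \<le> v}" using y(1) interior_mono by blast
      then show False using uv I[OF uv(1)] by simp
    qed
  qed
  moreover have "B \<subseteq> C" using I by (auto simp: C_def)
  ultimately have "C = B" by (rule maximal_free_convex_eq[OF max])
  then show ?thesis using polyC by simp
qed

text \<open>If no point of \<open>S\<close> lies in the relative interior of a facet, then that facet can be moved
  outwards, because a valid inequality takes a discrete set of values at the points of \<open>S\<close>
  close to \<open>B\<close>.\<close>

lemma maximal_facet_points:
  assumes max: "maximal_free_convex S B" and int: "interior B \<noteq> {}" and facet: "C facet_of B"
  shows "rel_interior C \<inter> S \<noteq> {}"
proof
  assume none: "rel_interior C \<inter> S = {}"
  let ?L = "lineality_space B"
  have convB: "convex B" and free: "interior B \<inter> S = {}"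
    using max by (auto simp: maximal_free_convex_def free_convex_def)
  have B0: "B \<noteq> {}" using int interior_subset by blast
  obtain \<pi> :: "'a \<Rightarrow> 'a" where \<pi>0: "linear \<pi>" "\<forall>x. x - \<pi> x \<in> ?L" "\<forall>x\<in>?L. \<pi> x = 0"
    by (rule subspace_projection_exists[OF subspace_lineality])
  note \<pi> = \<pi>0(1) \<pi>0(2,3)[rule_format]
  have mm: "monoid_mod_subspace G ?L \<pi>"
    using finG subspace_lineality \<pi> by (intro monoid_mod_subspace.intro)
  interpret mm: monoid_mod_subspace G ?L \<pi> by (rule mm)
  have fin: "finite (\<pi> ` nat_span G \<inter> cball 0 R)" for R
    by (intro mm.finite_mod maximal_discrete[OF max int mm])
  obtain H :: "'a set set" and a b where H0: "finite H" "B = {x. \<forall>h\<in>H. a h \<bullet> x \<le> b h}"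
    "interior B = {x. \<forall>h\<in>H. a h \<bullet> x < b h}"
    "\<forall>C. C facet_of B \<longleftrightarrow> (\<exists>h. h \<in> H \<and> C = B \<inter> {x. a h \<bullet> x = b h})"
    "\<forall>h\<in>H. a h \<noteq> 0"
    "\<forall>h\<in>H. \<exists>z. b h < a h \<bullet> z \<and> (\<forall>i\<in>H - {h}. a i \<bullet> z \<le> b i)"
    by (rule polyhedron_irredundant[OF maximal_polyhedron[OF max int] int])
  note H = H0(1-3) H0(4-6)[rule_format]
  obtain h where h: "h \<in> H" "C = B \<inter> {x. a h \<bullet> x = b h}" using facet H(4) by blast
  have aL: "a i \<bullet> l = 0" if "i \<in> H" "l \<in> ?L" for i l
    using valid_inequality_lineality[OF B0, of "a i" "b i" l] H(2) that by blast
  define D where "D = (\<lambda>i. (a i, b i)) ` H"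
  have "\<exists>R. \<forall>f\<in>F. \<forall>m\<in>nat_span G. R < norm (\<pi> m) \<longrightarrow> (\<exists>(p, q)\<in>D. q + 1 < p \<bullet> (f + m))"
  proof (rule mm.far_points_violate[OF finF])
    show "p \<bullet> l = 0" if "(p, q) \<in> D" "l \<in> ?L" for p q l
      using that aL by (auto simp: D_def)
    fix d assume d: "d \<in> \<pi> ` K" "d \<noteq> 0"
    then have "d \<notin> recession_cone B" using recession_projection_trivial[OF max int mm] by blast
    then obtain x l where x: "x \<in> B" "0 \<le> l" "x + l *\<^sub>R d \<notin> B" by (auto simp: recession_cone_def)
    then obtain i where i: "i \<in> H" "b i < a i \<bullet> (x + l *\<^sub>R d)" using H(2) by (auto simp: not_le)
    have "a i \<bullet> x \<le> b i" using x(1) H(2) i(1) by auto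
    then have "0 < l * (a i \<bullet> d)" using i(2) by (simp add: inner_add_right)
    then have "0 < a i \<bullet> d" using x(2) by (simp add: zero_less_mult_iff)
    then show "\<exists>(p, q)\<in>D. 0 < p \<bullet> d" using i(1) by (auto simp: D_def)
  qed
  then obtain R where R: "\<And>f m. f \<in> F \<Longrightarrow> m \<in> nat_span G \<Longrightarrow> R < norm (\<pi> m) \<Longrightarrow>
      \<exists>(p, q)\<in>D. q + 1 < p \<bullet> (f + m)" by blast
  \<comment> \<open>The levels of the facet inequality at points of \<open>S\<close> beyond the
    facet and within the unit slack. Each level depends only on \<open>f\<close> and on the
    projection of \<open>m\<close>, which leaves finitely many.\<close>
  define T where "T = {a h \<bullet> y |y. y \<in> S \<and> b h < a h \<bullet> y \<and> (\<forall>i\<in>H. a i \<bullet> y \<le> b i + 1)}"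
  have "T \<subseteq> (\<lambda>(f, v). a h \<bullet> f + a h \<bullet> v) ` (F \<times> (\<pi> ` nat_span G \<inter> cball 0 R))"
  proof
    fix t assume "t \<in> T"
    then obtain y where y: "t = a h \<bullet> y" "y \<in> S" "\<forall>i\<in>H. a i \<bullet> y \<le> b i + 1" by (auto simp: T_def)
    obtain f m where fm: "y = f + m" "f \<in> F" "m \<in> nat_span G" using y(2) by (auto simp: S_eq)
    have "\<not> R < norm (\<pi> m)"
    proof
      assume "R < norm (\<pi> m)"
      then obtain i where "i \<in> H" "b i + 1 < a i \<bullet> y" using R[OF fm(2,3)] fm(1) by (auto simp: D_def)
      then show False using y(3) by force
    qed
    then have "(f, \<pi> m) \<in> F \<times> (\<pi> ` nat_span G \<inter> cball 0 R)" using fm by auto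
    moreover have "a h \<bullet> (m - \<pi> m) = 0" using aL[OF h(1) \<pi>(2)] .
    then have "t = a h \<bullet> f + a h \<bullet> \<pi> m" by (simp add: y(1) fm(1) inner_add_right inner_diff_right)
    ultimately show "t \<in> (\<lambda>(f, v). a h \<bullet> f + a h \<bullet> v) ` (F \<times> (\<pi> ` nat_span G \<inter> cball 0 R))"
      by (intro image_eqI[of _ _ "(f, \<pi> m)"]) auto
  qed
  then have "finite T" by (rule finite_subset) (use finF fin in blast)
  then obtain e where e: "0 < e" "e \<le> 1" "\<And>t. t \<in> T \<Longrightarrow> b h + e \<le> t"
    by (rule finite_gap_above[of T "b h"]) (auto simp: T_def)
  \<comment> \<open>Only \<open>h\<close> is relaxed, and no further than the first level in
    \<open>T\<close>, so no point of \<open>S\<close> becomes interior by passing the facet.\<close>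
  define b' where "b' = b(h := b h + e)"
  define B' where "B' = (\<Inter>i\<in>H. {x. a i \<bullet> x \<le> b' i})"
  have convB': "convex B'" unfolding B'_def by (intro convex_INT convex_halfspace_le)
  have bb': "b i \<le> b' i" "b' i \<le> b i + 1" for i using e(1,2) by (auto simp: b'_def)
  have "interior B' \<inter> S = {}"
  proof (rule ccontr)
    assume "\<not> ?thesis"
    then obtain y where y: "y \<in> interior B'" "y \<in> S" by blast
    have lt: "a i \<bullet> y < b' i" if i: "i \<in> H" for i
    proof -
      have "B' \<subseteq> {x. a i \<bullet> x \<le> b' i}" using i by (auto simp: B'_def)
      then have "y \<in> interior {x. a i \<bullet> x \<le> b' i}" using y(1) interior_mono by blast
      then show ?thesis using H(5)[OF i] by simp
    qed
    have others: "a i \<bullet> y < b i" if "i \<in> H" "i \<noteq> h" for i using lt[OF that(1)] that(2) by (simp add: b'_def)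
    have le1: "a i \<bullet> y \<le> b i + 1" if "i \<in> H" for i using lt[OF that] bb'(2)[of i] by linarith
    have "a h \<bullet> y \<le> b h"
    proof (rule ccontr)
      assume "\<not> ?thesis"
      then have "a h \<bullet> y \<in> T" using y(2) le1 unfolding T_def by auto
      then have "b' h \<le> a h \<bullet> y" using e(3) by (simp add: b'_def)
      then show False using lt[OF h(1)] by simp
    qed
    moreover have "a h \<bullet> y \<noteq> b h"
    proof
      assume eq: "a h \<bullet> y = b h"
      \<comment> \<open>Where only \<open>h\<close> is tight, this open set meets the affine hull of
        \<open>C\<close> inside \<open>C\<close>, which makes \<open>y\<close> a relative interior
        point.\<close>
      let ?U = "\<Inter>i\<in>H - {h}. {x. a i \<bullet> x < b i}"
      have "open ?U" using H(1) by (intro open_INT) (auto simp: open_halfspace_lt)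
      moreover have "a i \<bullet> y \<le> b i" if "i \<in> H" for i
        using others[of i] eq that by (cases "i = h") auto
      then have "y \<in> C" using eq h(2) H(2) by auto
      moreover have "y \<in> ?U" using others by auto
      moreover have "?U \<inter> affine hull C \<subseteq> C"
      proof
        fix x assume x: "x \<in> ?U \<inter> affine hull C"
        have "affine hull C \<subseteq> {x. a h \<bullet> x = b h}"
          using h(2) by (intro hull_minimal affine_hyperplane) auto
        then have "a h \<bullet> x = b h" using x by blast
        moreover have "a i \<bullet> x \<le> b i" if "i \<in> H" for i
          using x calculation that by (cases "i = h") (auto intro: less_imp_le)
        ultimately show "x \<in> C" using h(2) H(2) by auto
      qed
      ultimately have "y \<in> rel_interior C" unfolding mem_rel_interior by blast
      then show False using none y(2) by blast
    qed
    ultimately have "y \<in> interior B" using others H(3) by force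
    then show False using free y(2) by blast
  qed
  then have "free_convex S B'" using convB' by (simp add: free_convex_def)
  moreover have "B \<subseteq> B'"
    unfolding B'_def H(2) using bb'(1) by (auto intro: order_trans)
  ultimately have eq: "B' = B" by (rule maximal_free_convex_eq[OF max])
  obtain z where z: "b h < a h \<bullet> z" "\<forall>i\<in>H - {h}. a i \<bullet> z \<le> b i" using H(6)[OF h(1)] by blast
  obtain z0 where z0: "\<And>i. i \<in> H \<Longrightarrow> a i \<bullet> z0 \<le> b i" using B0 H(2) by auto
  have den: "0 < a h \<bullet> z - a h \<bullet> z0" using z0[OF h(1)] z(1) by simp
  \<comment> \<open>A level above \<open>b h\<close>, still allowed in \<open>B'\<close>, that
    occurs on the segment from \<open>z0\<close> to \<open>z\<close>; the point \<open>q\<close> at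
    this level is in \<open>B'\<close> but not in \<open>B\<close>.\<close>
  define c where "c = min (b h + e) (a h \<bullet> z)"
  define \<theta> where "\<theta> = (c - a h \<bullet> z0) / (a h \<bullet> z - a h \<bullet> z0)"
  have c: "b h < c" "c \<le> b h + e" "c \<le> a h \<bullet> z" using e(1) z(1) by (auto simp: c_def)
  have \<theta>: "0 \<le> \<theta>" "\<theta> \<le> 1" "\<theta> * (a h \<bullet> z - a h \<bullet> z0) = c - a h \<bullet> z0"
    using z0[OF h(1)] c den by (auto simp: \<theta>_def)
  define q where "q = (1 - \<theta>) *\<^sub>R z0 + \<theta> *\<^sub>R z"
  have aq: "x \<bullet> q = (1 - \<theta>) * (x \<bullet> z0) + \<theta> * (x \<bullet> z)" for x by (simp add: q_def inner_add_right)
  have ahq: "a h \<bullet> q = c" using \<theta>(3) unfolding aq by (simp add: algebra_simps)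
  have "a i \<bullet> q \<le> b' i" if i: "i \<in> H" for i
  proof (cases "i = h")
    case True
    then show ?thesis using ahq c(2) by (simp add: b'_def)
  next
    case False
    have "(1 - \<theta>) * (a i \<bullet> z0) \<le> (1 - \<theta>) * b i" using z0[OF i] \<theta>(2) by (simp add: mult_left_mono)
    moreover have "\<theta> * (a i \<bullet> z) \<le> \<theta> * b i" using z(2) i False \<theta>(1) by (simp add: mult_left_mono)
    ultimately show ?thesis using False unfolding aq by (simp add: b'_def algebra_simps)
  qed
  then have "q \<in> B" using eq by (auto simp: B'_def)
  then show False using ahq c(1) h(1) H(2) by force
qed

text \<open>A separating hyperplane need not touch \<open>S\<close>. Boundedness of \<open>a\<close>
  below on \<open>S\<close> makes \<open>a\<close> nonnegative on the generators, so its minimum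
  over \<open>S\<close> is attained in \<open>F\<close>; the half-space up to this minimum is free
  and contains \<open>B\<close>.\<close>

lemma maximal_halfspace:
  assumes max: "maximal_free_convex S B" and int: "interior B \<noteq> {}"
    and intS: "interior (convex hull S) \<noteq> {}"
    and disj: "interior (B \<inter> convex hull S) = {}"
  shows "is_halfspace B" "supporting_hyperplane (frontier B) (convex hull S)"
proof -
  have convB: "convex B" using max by (simp add: maximal_free_convex_def free_convex_def)
  have "interior B \<inter> interior (convex hull S) = {}" using disj by (simp add: interior_Int)
  then obtain a b where ab: "a \<noteq> 0" "\<forall>x\<in>interior B. a \<bullet> x \<le> b" "\<forall>x\<in>interior (convex hull S). b \<le> a \<bullet> x"
    using separating_hyperplane_sets[OF convex_interior[OF convB] convex_interior[OF convex_convex_hull] int intS]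
    by blast
  have B: "a \<bullet> x \<le> b" if "x \<in> B" for x
    using closed_halfspace_of_interior[OF convB int _ that] ab(2) by blast
  have S: "b \<le> a \<bullet> x" if "x \<in> convex hull S" for x
    using closed_halfspace_of_interior[OF convex_convex_hull intS _ that, of "- a" "- b"] ab(3) by simp
  have G0: "0 \<le> a \<bullet> g" if g: "g \<in> G" for g
  proof (rule ccontr)
    assume n: "\<not> 0 \<le> a \<bullet> g"
    obtain f where f: "f \<in> F" using F_nonempty by blast
    obtain n :: nat where "(a \<bullet> f - b) / (- (a \<bullet> g)) < real n" using reals_Archimedean2 by blast
    then have "a \<bullet> f + real n * (a \<bullet> g) < b" using n by (simp add: field_simps)
    moreover have "f + real n *\<^sub>R g \<in> S"
      using f F_subset_S g nat_span_base[OF finG] by (intro S_add nat_span_mult) auto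
    then have "b \<le> a \<bullet> (f + real n *\<^sub>R g)" by (intro S hull_inc)
    ultimately show False by (simp add: inner_add_right)
  qed
  define c where "c = Min ((\<lambda>f. a \<bullet> f) ` F)"
  have "c \<in> (\<lambda>f. a \<bullet> f) ` F" unfolding c_def using finF F_nonempty by (intro Min_in) auto
  then obtain f0 where f0: "f0 \<in> F" "a \<bullet> f0 = c" by auto
  then have f0S: "f0 \<in> S" using F_subset_S by blast
  have Sc: "c \<le> a \<bullet> s" if s: "s \<in> S" for s
  proof -
    obtain f p where fp: "s = f + (\<Sum>g\<in>G. real (p g) *\<^sub>R g)" "f \<in> F"
      using s by (auto simp: S_eq nat_span_def)
    have "c \<le> a \<bullet> f" unfolding c_def using fp(2) finF by simp
    moreover have "0 \<le> a \<bullet> (\<Sum>g\<in>G. real (p g) *\<^sub>R g)"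
      unfolding inner_sum_right using G0 by (intro sum_nonneg) auto
    ultimately show ?thesis by (simp add: fp(1) inner_add_right)
  qed
  have "b \<le> c" using S[OF hull_inc[OF f0S]] f0(2) by simp
  then have "B \<subseteq> {x. a \<bullet> x \<le> c}" using B by (auto intro: order_trans)
  moreover have "free_convex S {x. a \<bullet> x \<le> c}"
    using halfspace_is_maximal[OF ab(1) Sc f0S f0(2)] by (simp add: maximal_free_convex_def)
  ultimately have B_eq: "{x. a \<bullet> x \<le> c} = B" by (intro maximal_free_convex_eq[OF max])
  then show "is_halfspace B" using ab(1) by (auto simp: is_halfspace_def)
  have fr: "frontier B = {x. a \<bullet> x = c}" unfolding B_eq[symmetric] using ab(1) by (simp add: frontier_halfspace_le)
  have "convex hull S \<subseteq> {x. a \<bullet> x \<ge> c}"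
    using Sc by (intro hull_minimal convex_halfspace_ge) auto
  moreover have "f0 \<in> frontier B \<inter> convex hull S" using fr f0(2) hull_inc[OF f0S] by auto
  ultimately show "supporting_hyperplane (frontier B) (convex hull S)"
    unfolding supporting_hyperplane_def fr using ab(1) by blast
qed

text \<open>Contact with the hull implies contact with \<open>S\<close>: otherwise \<open>S\<close>,
  and with it the hull, would lie in the open half-space.\<close>

lemma maximal_of_supporting_halfspace:
  assumes half: "is_halfspace B" and disj: "interior (B \<inter> convex hull S) = {}"
    and intS: "interior (convex hull S) \<noteq> {}"
    and supp: "supporting_hyperplane (frontier B) (convex hull S)"
  shows "maximal_free_convex S B"
proof -
  obtain a b where ab: "a \<noteq> 0" "B = {x. a \<bullet> x \<le> b}" using half by (auto simp: is_halfspace_def)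
  have "\<not> a \<bullet> x < b" if "x \<in> interior (convex hull S)" for x
    using disj that ab by (auto simp: interior_Int)
  then have "- a \<bullet> x \<le> - b" if "x \<in> convex hull S" for x
    using closed_halfspace_of_interior[OF convex_convex_hull intS _ that, of "- a" "- b"]
    by (simp add: not_less)
  then have hull_ge: "b \<le> a \<bullet> x" if "x \<in> convex hull S" for x using that by fastforce
  have "\<exists>s\<in>S. a \<bullet> s = b"
  proof (rule ccontr)
    assume "\<not> ?thesis"
    then have "S \<subseteq> {x. b < a \<bullet> x}" using hull_ge hull_inc by (force simp: less_le)
    then have "convex hull S \<subseteq> {x. b < a \<bullet> x}" by (intro hull_minimal convex_halfspace_gt)
    moreover have "frontier B = {x. a \<bullet> x = b}" using ab by (simp add: frontier_halfspace_le)
    ultimately show False using supp by (auto simp: supporting_hyperplane_def)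
  qed
  then show ?thesis
    unfolding ab(2) using halfspace_is_maximal[OF ab(1), of S b] hull_ge hull_inc by metis
qed

text \<open>A larger convex set contains an open strip \<open>Z\<close> next to the hyperplane. The
  transversal line \<open>d\<close> reaches the strip from any point of \<open>S\<close>;
  approximating it by \<open>M + L\<close> and dropping the part in \<open>L\<close>, which does not
  change the level, gives a point of \<open>S\<close> in the strip.\<close>

lemma hyperplane_maximal_of_dense:
  assumes "a \<noteq> 0"
    and dense: "\<not> monoid_mod_subspace.discrete_mod G {x. a \<bullet> x = 0} (normal_part a)"
  shows "maximal_free_convex S {x. a \<bullet> x = b}"
proof -
  interpret mm: monoid_mod_subspace G "{x. a \<bullet> x = 0}" "normal_part a"
    using finG assms(1) by (rule monoid_mod_hyperplane)
  obtain d where d: "a \<bullet> d \<noteq> 0" "\<And>t. t *\<^sub>R d \<in> mm.A" using mm.line_of_tiny[OF dense] by auto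
  have "\<not> {x. a \<bullet> x = b} \<subset> C" if C: "free_convex S C" for C
  proof
    assume sub: "{x. a \<bullet> x = b} \<subset> C"
    then obtain c where c: "c \<in> C" "a \<bullet> c \<noteq> b" by blast
    define Z where "Z = {x. \<exists>\<theta>. 0 < \<theta> \<and> \<theta> < 1 \<and> a \<bullet> x = b + \<theta> * (a \<bullet> c - b)}"
    have Z_iff: "x \<in> Z \<longleftrightarrow> 0 < (a \<bullet> x - b) / (a \<bullet> c - b) \<and> (a \<bullet> x - b) / (a \<bullet> c - b) < 1" for x
    proof -
      have "a \<bullet> x = b + \<theta> * (a \<bullet> c - b) \<longleftrightarrow> \<theta> = (a \<bullet> x - b) / (a \<bullet> c - b)" for \<theta>
        using c(2) by (auto simp: field_simps)
      then show ?thesis by (auto simp: Z_def)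
    qed
    have "open Z"
    proof -
      have "Z = {x. 0 < (a \<bullet> x - b) / (a \<bullet> c - b)} \<inter> {x. (a \<bullet> x - b) / (a \<bullet> c - b) < 1}"
        using Z_iff by auto
      also have "open \<dots>"
        using c(2) by (intro open_Int open_Collect_less continuous_intros) auto
      finally show ?thesis .
    qed
    have "Z \<subseteq> C"
    proof
      fix x assume "x \<in> Z"
      then obtain \<theta> where \<theta>: "0 < \<theta>" "\<theta> < 1" "a \<bullet> x = b + \<theta> * (a \<bullet> c - b)" by (auto simp: Z_def)
      define y where "y = (1 / (1 - \<theta>)) *\<^sub>R (x - \<theta> *\<^sub>R c)"
      have "a \<bullet> x - \<theta> * (a \<bullet> c) = (1 - \<theta>) * b" using \<theta>(3) by (simp add: algebra_simps)
      then have "a \<bullet> y = b" using \<theta>(2) by (simp add: y_def inner_diff_right)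
      then have "y \<in> C" using sub by blast
      moreover have "x = (1 - \<theta>) *\<^sub>R y + \<theta> *\<^sub>R c" using \<theta>(2) by (simp add: y_def)
      ultimately show "x \<in> C"
        using C c(1) \<theta> convexD[of C y c "1 - \<theta>" \<theta>] by (auto simp: free_convex_def)
    qed
    obtain y where y: "y \<in> S" using F_nonempty F_subset_S by blast
    \<comment> \<open>Aims at the level halfway between \<open>b\<close> and
      \<open>a \<bullet> c\<close>.\<close>
    define t where "t = ((a \<bullet> c + b) / 2 - a \<bullet> y) / (a \<bullet> d)"
    have "a \<bullet> (y + t *\<^sub>R d) = b + 1 / 2 * (a \<bullet> c - b)"
      using d(1) by (simp add: t_def inner_add_right field_simps)
    then have "y + t *\<^sub>R d \<in> Z" unfolding Z_def by (intro CollectI exI[of _ "1 / 2"]) simp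
    then obtain e where e: "0 < e" "ball (y + t *\<^sub>R d) e \<subseteq> Z" using \<open>open Z\<close> open_contains_ball by blast
    obtain m l where ml: "m \<in> nat_span G" "a \<bullet> l = 0" "dist (m + l) (t *\<^sub>R d) < e"
      using d(2)[of t] e(1) unfolding mm.A_def closure_approachable by blast
    have "y + (m + l) \<in> Z" using ml(3) e(2) by (auto simp: dist_norm norm_minus_commute)
    then have "y + m \<in> Z" using ml(2) by (simp add: Z_iff inner_add_right)
    moreover have "Z \<subseteq> interior C" using \<open>Z \<subseteq> C\<close> \<open>open Z\<close> by (rule interior_maximal)
    moreover have "y + m \<in> S" using y ml(1) by (rule S_add)
    ultimately show False using C by (auto simp: free_convex_def)
  qed
  moreover have "free_convex S {x. a \<bullet> x = b}" using assms(1) by (simp add: free_convex_def convex_hyperplane)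
  ultimately show ?thesis by (simp add: maximal_free_convex_def)
qed

text \<open>Discreteness leaves finitely many levels of \<open>S\<close> between \<open>b\<close>
  and \<open>b + 1\<close>, so a thin slab on one side of the hyperplane is free.\<close>

lemma hyperplane_not_maximal_of_discrete:
  assumes "a \<noteq> 0"
    and disc: "monoid_mod_subspace.discrete_mod G {x. a \<bullet> x = 0} (normal_part a)"
  shows "\<not> maximal_free_convex S {x. a \<bullet> x = b}"
proof
  assume max: "maximal_free_convex S {x. a \<bullet> x = b}"
  interpret mm: monoid_mod_subspace G "{x. a \<bullet> x = 0}" "normal_part a"
    using finG assms(1) by (rule monoid_mod_hyperplane)
  \<comment> \<open>Bounds \<open>\<bar>a \<bullet> m\<bar>\<close> whenever the level of
    \<open>f + m\<close> lies between \<open>b\<close> and \<open>b + 1\<close>.\<close>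
  define C where "C = 1 + \<bar>b\<bar> + (\<Sum>f\<in>F. \<bar>a \<bullet> f\<bar>)"
  let ?V = "normal_part a ` nat_span G \<inter> cball 0 (C / norm a)"
  define T where "T = {a \<bullet> s |s. s \<in> S \<and> b < a \<bullet> s \<and> a \<bullet> s < b + 1}"
  have "T \<subseteq> (\<lambda>(f, v). a \<bullet> f + a \<bullet> v) ` (F \<times> ?V)"
  proof
    fix t assume "t \<in> T"
    then obtain f m where fm: "t = a \<bullet> (f + m)" "f \<in> F" "m \<in> nat_span G" "b < t" "t < b + 1"
      by (auto simp: T_def S_eq)
    have "\<bar>a \<bullet> f\<bar> \<le> (\<Sum>f\<in>F. \<bar>a \<bullet> f\<bar>)" using fm(2) finF by (intro member_le_sum) auto
    then have "\<bar>a \<bullet> m\<bar> \<le> C" using fm(1,4,5) by (simp add: C_def inner_add_right abs_le_iff) linarith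
    then have "(f, normal_part a m) \<in> F \<times> ?V"
      using fm assms(1) by (auto simp: norm_normal_part divide_right_mono)
    moreover have "a \<bullet> normal_part a m = a \<bullet> m" using assms(1) by (simp add: normal_part_def)
    ultimately show "t \<in> (\<lambda>(f, v). a \<bullet> f + a \<bullet> v) ` (F \<times> ?V)"
      using fm(1) by (intro image_eqI[of _ _ "(f, normal_part a m)"]) (auto simp: inner_add_right)
  qed
  then have "finite T" by (rule finite_subset) (use finF mm.finite_mod[OF disc] in blast)
  then obtain e where e: "0 < e" "e \<le> 1" "\<And>t. t \<in> T \<Longrightarrow> b + e \<le> t"
    by (rule finite_gap_above[of T b]) (auto simp: T_def)
  let ?C = "{x. a \<bullet> x \<ge> b} \<inter> {x. a \<bullet> x \<le> b + e}"
  have "free_convex S ?C"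
    unfolding free_convex_def
  proof
    show "convex ?C" by (intro convex_Int convex_halfspace_ge convex_halfspace_le)
    have "s \<notin> S" if s: "b < a \<bullet> s" "a \<bullet> s < b + e" for s
    proof
      assume "s \<in> S"
      then have "a \<bullet> s \<in> T" using s e(2) by (auto simp: T_def)
      then show False using e(3) s(2) by force
    qed
    then show "interior ?C \<inter> S = {}" using assms(1) by auto
  qed
  moreover have "{x. a \<bullet> x = b} \<subseteq> ?C" using e(1) by auto
  ultimately have eq: "?C = {x. a \<bullet> x = b}" by (rule maximal_free_convex_eq[OF max])
  have "a \<bullet> (((b + e) / (a \<bullet> a)) *\<^sub>R a) = b + e" using assms(1) by simp
  then have "((b + e) / (a \<bullet> a)) *\<^sub>R a \<in> ?C" using e(1) by simp
  then show False unfolding eq using \<open>a \<bullet> (((b + e) / (a \<bullet> a)) *\<^sub>R a) = b + e\<close> e(1) by simp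
qed

end

section \<open>The characterisation for the integral points of a rational polyhedron\<close>

lemma full_dimensional_interior:
  fixes S :: "(real^'n) set"
  assumes "full_dimensional S"
  shows "interior (convex hull S) \<noteq> {}"
proof -
  obtain T where T: "T \<subseteq> S" "\<not> affine_dependent T" "card T = CARD('n) + 1"
    using assms by (auto simp: full_dimensional_def)
  then have "interior (convex hull T) \<noteq> {}" by (subst interior_convex_hull_eq_empty) auto
  moreover have "convex hull T \<subseteq> convex hull S" using T(1) by (rule hull_mono)
  ultimately show ?thesis using interior_mono by blast
qed

theorem theorem2:
  fixes P S B :: "(real ^ 'n) set"
  assumes "rational_polyhedron P"
    and "S = P \<inter> integral_points"
    and "full_dimensional S"
  shows "(maximal_free_convex S B \<longleftrightarrow>
            (polyhedron B \<and> interior (B \<inter> convex hull S) \<noteq> {} \<and> interior B \<inter> S = {} \<and>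
             (\<forall>F. F facet_of B \<longrightarrow> rel_interior F \<inter> S \<noteq> {})) \<or>
            (is_halfspace B \<and> interior (B \<inter> convex hull S) = {} \<and>
             supporting_hyperplane (frontier B) (convex hull S)) \<or>
            (is_hyperplane B \<and>
             \<not> rational_cone (lineality_space B \<inter> recession_cone (convex hull S))))
       \<and>
         (polyhedron B \<and> interior (B \<inter> convex hull S) \<noteq> {} \<and> interior B \<inter> S = {} \<and>
          (\<forall>F. F facet_of B \<longrightarrow> rel_interior F \<inter> S \<noteq> {}) \<longrightarrow>
            rational_cone (recession_cone (B \<inter> convex hull S)) \<and>
            recession_cone (B \<inter> convex hull S) \<subseteq> lineality_space B)"
    (is "(_ \<longleftrightarrow> ?i \<or> ?ii \<or> ?iii) \<and> (_ \<longrightarrow> ?rec)")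
proof -
  have intS: "interior (convex hull S) \<noteq> {}" using assms(3) by (rule full_dimensional_interior)
  obtain F G where FG: "finite F" "finite G" "G \<subseteq> integral_points"
    "S = {f + u |f u. f \<in> F \<and> u \<in> nat_span G}"
    unfolding assms(2) by (rule int_points_of_rational_polyhedron[OF assms(1)])
  have "F \<noteq> {}" using intS FG(4) by auto
  then interpret finitely_generated_points F G S using FG by unfold_locales
  have GQ: "G \<subseteq> rational_points" using FG(3) integral_subset_rational by blast
  have i: ?i if max: "maximal_free_convex S B" and int: "interior (B \<inter> convex hull S) \<noteq> {}"
  proof -
    have "interior B \<noteq> {}" using int by (auto simp: interior_Int)
    then show ?thesis
      using max int maximal_polyhedron[OF max] maximal_facet_points[OF max]
      by (auto simp: maximal_free_convex_def free_convex_def)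
  qed
  \<comment> \<open>Rationality of \<open>L \<inter> K\<close> is equivalent to discreteness of the
    monoid modulo the hyperplane direction \<open>L\<close>, and discreteness decides maximality, so
    both directions come at once.\<close>
  have hyp: "maximal_free_convex S B \<longleftrightarrow> ?iii" if H: "is_hyperplane B"
  proof -
    obtain a b where ab: "a \<noteq> 0" "B = {x. a \<bullet> x = b}" using H by (auto simp: is_hyperplane_def)
    have "?iii \<longleftrightarrow> \<not> rational_cone ({x. a \<bullet> x = 0} \<inter> K)"
      using H by (simp add: recession_hull lineality_hyperplane[OF ab(1)] ab(2))
    moreover have "rational_cone ({x. a \<bullet> x = 0} \<inter> K) \<longleftrightarrow>
        monoid_mod_subspace.discrete_mod G {x. a \<bullet> x = 0} (normal_part a)"
      using rational_cone_of_discrete_mod[OF monoid_mod_hyperplane[OF finG ab(1)] GQ]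
        discrete_mod_of_rational_cone[OF finG GQ ab(1)] by blast
    ultimately show ?thesis
      using hyperplane_maximal_of_dense[OF ab(1)] hyperplane_not_maximal_of_discrete[OF ab(1)]
      unfolding ab(2) by blast
  qed
  have "?i \<or> ?ii \<or> ?iii" if max: "maximal_free_convex S B"
  proof (cases "interior B = {}")
    case True
    have "convex B" using max by (simp add: maximal_free_convex_def free_convex_def)
    \<comment> \<open>A convex set with empty interior lies in a hyperplane, which is itself free,
      so maximality gives equality.\<close>
    then obtain a b where ab: "a \<noteq> 0" "B \<subseteq> {x. a \<bullet> x = b}"
      using empty_interior_subset_hyperplane[OF _ True] by blast
    have "free_convex S {x. a \<bullet> x = b}" using ab(1) by (simp add: free_convex_def convex_hyperplane)
    then have "{x. a \<bullet> x = b} = B" using ab(2) by (rule maximal_free_convex_eq[OF max])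
    then have "is_hyperplane B" using ab(1) by (auto simp: is_hyperplane_def)
    then show ?thesis using hyp max by blast
  next
    case False
    then show ?thesis using i[OF max] maximal_halfspace[OF max False intS] by blast
  qed
  moreover have max_i: "maximal_free_convex S B" if ?i
  proof -
    have "interior B \<noteq> {}" using that by (auto simp: interior_Int)
    then show ?thesis using that by (intro maximal_of_facet_points) auto
  qed
  moreover have "maximal_free_convex S B" if ?ii
    using that maximal_of_supporting_halfspace[OF _ _ intS] by blast
  moreover have "maximal_free_convex S B" if ?iii using that hyp by blast
  moreover have ?rec if ?i
  proof -
    have max: "maximal_free_convex S B" using max_i that by blast
    have int: "interior B \<noteq> {}" using that by (auto simp: interior_Int)
    have convB: "convex B" using max by (simp add: maximal_free_convex_def free_convex_def)
    have "B \<inter> convex hull S \<noteq> {}" using that interior_subset by blast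
    then have "recession_cone (B \<inter> convex hull S) = recession_cone B \<inter> K"
      using recession_cone_Int[OF maximal_free_convex_closed[OF max] convB closed_hull convex_convex_hull]
      by (simp add: recession_hull)
    \<comment> \<open>This gives the containment and reduces rationality to discreteness modulo the
      lineality space.\<close>
    also have "\<dots> = lineality_space B \<inter> K"
      using maximal_recession[OF max int] lineality_subset_recession by blast
    finally have eq: "recession_cone (B \<inter> convex hull S) = lineality_space B \<inter> K" .
    obtain \<pi> :: "real^'n \<Rightarrow> real^'n" where \<pi>0: "linear \<pi>" "\<forall>x. x - \<pi> x \<in> lineality_space B"
      "\<forall>x\<in>lineality_space B. \<pi> x = 0"
      by (rule subspace_projection_exists[OF subspace_lineality])
  note \<pi> = \<pi>0(1) \<pi>0(2,3)[rule_format]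
    have mm: "monoid_mod_subspace G (lineality_space B) \<pi>"
      using finG subspace_lineality \<pi> by (intro monoid_mod_subspace.intro)
    show ?thesis
      unfolding eq using rational_cone_of_discrete_mod[OF mm GQ maximal_discrete[OF max int mm]] by blast
  qed
  ultimately show ?thesis by blast
qed

end
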